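(* Let $0<p<2$ and let $(\mathbf{B},\|\cdot\|)$ be a real separable Banach space. Let $\{X,X_n;\,n\ge1\}$ be a sequence of i.i.d. $\mathbf{B}$-valued random variables and set $S_n=\sum_{i=1}^n X_i$, $n\ge1$. Suppose that $$\frac{S_n}{n^{1/p}}\to 0 \quad\text{in probability}.$$ Then for all $s>0$, $$\limsup_{n\to\infty}\frac{1}{\log n}\log\mathbb{P}\left(\|S_n\|>s n^{1/p}\right)=-\frac{\bar\beta-p}{p}$$ and $$\liminf_{n\to\infty}\frac{1}{\log n}\log\mathbb{P}\left(\|S_n\|>s n^{1/p}\right)=-\frac{\underline\beta-p}{p}.$$ Consequently, under the same hypothesis, for all $s>0$ and any $\hat\beta\in[0,\infty]$, $\lim_{n\to\infty}\frac{1}{\log n}\log\mathbb{P}(\|S_n\|>sn^{1/p})=-(\hat\beta-p)/p$ if and only if $\bar\beta=\underline\beta=\hat\beta$.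
   Context: For a $\mathbf{B}$-valued random variable $X$ define $$\bar\beta=-\limsup_{t\to\infty}\frac1t\log\mathbb{P}(\log\|X\|>t)\in[0,\infty],\qquad \underline\beta=-\liminf_{t\to\infty}\frac1t\log\mathbb{P}(\log\|X\|>t)\in[0,\infty].$$ Conventions: $\log 0=-\infty$; for real $x\in(0,\infty)$ and $y\in\mathbb{R}$, $(\pm\infty+y)/x=\pm\infty$. *)

theory Defs
  imports "HOL-Probability.Probability"
begin

text \<open>Extended-real logarithm with the convention log 0 = -infinity
  (used for probabilities, which are nonnegative).\<close>
definition elog :: "real \<Rightarrow> ereal" where
  "elog x = (if x \<le> 0 then -\<infinity> else ereal (ln x))"

text \<open>The event {log norm Y > t}, with log 0 = -infinity.\<close>
definition log_norm_gt :: "'a measure \<Rightarrow> ('a \<Rightarrow> 'b::real_normed_vector) \<Rightarrow> real \<Rightarrow> 'a set" where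
  "log_norm_gt M Y t = {\<omega> \<in> space M. norm (Y \<omega>) > 0 \<and> ln (norm (Y \<omega>)) > t}"

definition beta_upper :: "'a measure \<Rightarrow> ('a \<Rightarrow> 'b::real_normed_vector) \<Rightarrow> ereal" where
  "beta_upper M Y = - Limsup at_top (\<lambda>t::real. ereal (1 / t) * elog (measure M (log_norm_gt M Y t)))"

definition beta_lower :: "'a measure \<Rightarrow> ('a \<Rightarrow> 'b::real_normed_vector) \<Rightarrow> ereal" where
  "beta_lower M Y = - Liminf at_top (\<lambda>t::real. ereal (1 / t) * elog (measure M (log_norm_gt M Y t)))"

definition tail_rate :: "'a measure \<Rightarrow> (nat \<Rightarrow> 'a \<Rightarrow> 'b::real_normed_vector) \<Rightarrow> real \<Rightarrow> real \<Rightarrow> nat \<Rightarrow> ereal" where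
  "tail_rate M S p s n = ereal (1 / ln (real n)) *
     elog (measure M {\<omega> \<in> space M. norm (S n \<omega>) > s * real n powr (1 / p)})"

end

theory Submission
  imports Defs "HOL-Real_Asymp.Real_Asymp"
begin

text \<open>
  Truncate the summands at \<open>n powr \<kappa>\<close> with \<open>\<kappa> < 1 / p\<close>. A Lipschitz function of a sum of independent
  bounded vectors has exponential moments controlled by the summands' second moments (replace one
  summand at a time by its expectation). The weak law forces \<open>P(\<parallel>X\<parallel> > t) = O(t powr - p)\<close>, so the
  truncated sum deviates from its mean norm by a multiple of \<open>n powr (1 / p)\<close> with probability smaller
  than any power of \<open>n\<close>; comparing this with the weak law itself also shows that the mean norm is small.
  Hence the tail of \<open>S n\<close> is at most \<open>4 n P(\<parallel>X\<parallel> > n powr \<kappa>)\<close> up to such an error. Conversely, the disjoint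
  events that exactly one summand is large give the lower bound \<open>(n / 4) P(\<parallel>X\<parallel> > 2 s n powr (1 / p))\<close>.
  Letting \<open>\<kappa>\<close> tend to \<open>1 / p\<close> yields both rates.
\<close>

section \<open>Exponential concentration for sums of bounded vectors\<close>

text \<open>Taylor's formula of order two; the exponential in the remainder is at most
  \<open>exp \<bar>u\<bar>\<close>. As \<open>u\<close> is arbitrary, any exponential parameter may
  be inserted later.\<close>

lemma exp_le_quadratic_exp_abs: "exp u \<le> 1 + u + u\<^sup>2 * exp \<bar>u\<bar>" for u :: real
proof -
  obtain t where t: "\<bar>t\<bar> \<le> \<bar>u\<bar>"
    and "exp u = (\<Sum>m<2. (u ^ m) / fact m) + (exp t / fact 2) * u ^ 2"
    using Maclaurin_exp_le[of u 2] by auto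
  then have "exp u = 1 + u + exp t / 2 * u\<^sup>2"
    by (simp add: numeral_2_eq_2)
  moreover have "exp t / 2 \<le> exp \<bar>u\<bar>"
    using t by (smt (verit) exp_gt_zero exp_le_cancel_iff field_sum_of_halves)
  then have "exp t / 2 * u\<^sup>2 \<le> exp \<bar>u\<bar> * u\<^sup>2"
    by (rule mult_right_mono) simp
  ultimately show ?thesis by (simp add: mult.commute)
qed

text \<open>After centring, the linear term of the quadratic expansion integrates to zero and only
  the variance remains, which is at most the second moment. The factor
  \<open>exp (2 * l * R)\<close> reflects that a variable bounded by \<open>R\<close> stays within
  \<open>2 * R\<close> of its mean.\<close>

lemma (in prob_space) expectation_exp_centered_le:
  fixes Z :: "'a \<Rightarrow> real"
  assumes [measurable]: "Z \<in> borel_measurable M"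
    and R: "\<And>\<omega>. \<omega> \<in> space M \<Longrightarrow> \<bar>Z \<omega>\<bar> \<le> R" and "0 \<le> l"
  shows "expectation (\<lambda>\<omega>. exp (l * Z \<omega>))
    \<le> exp (l\<^sup>2 * exp (2 * l * R) * expectation (\<lambda>\<omega>. (Z \<omega>)\<^sup>2)) * exp (l * expectation Z)"
proof -
  have R0: "0 \<le> R"
    using R not_empty by (meson abs_ge_zero equals0I order_trans)
  have Zint: "integrable M Z"
    by (rule integrable_const_bound[where B=R]) (auto simp: R)
  have Z2int: "integrable M (\<lambda>\<omega>. (Z \<omega>)\<^sup>2)"
    by (rule integrable_const_bound[where B="R\<^sup>2"]) (auto simp: R abs_le_square_iff[symmetric] R0)
  define m where "m = expectation Z"
  have "\<bar>m\<bar> \<le> R"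
    unfolding m_def abs_le_iff using R Zint
    by (auto intro!: integral_le_const integral_ge_const simp: abs_le_iff
        simp flip: Bochner_Integration.integral_minus)
  then have D: "\<bar>Z \<omega> - m\<bar> \<le> 2 * R" if "\<omega> \<in> space M" for \<omega>
    using R[OF that] by linarith
  have eint: "integrable M (\<lambda>\<omega>. exp (l * (Z \<omega> - m)))"
    by (rule integrable_const_bound[where B="exp (l * (2 * R))"])
       (use D \<open>0 \<le> l\<close> in \<open>auto intro!: mult_left_mono simp: abs_le_iff\<close>)
  have Dint: "integrable M (\<lambda>\<omega>. Z \<omega> - m)" and D2int: "integrable M (\<lambda>\<omega>. (Z \<omega> - m)\<^sup>2)"
    using Zint Z2int by (auto simp: power2_diff)
  have "expectation (\<lambda>\<omega>. exp (l * (Z \<omega> - m)))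
      \<le> expectation (\<lambda>\<omega>. 1 + l * (Z \<omega> - m) + l\<^sup>2 * exp (2 * l * R) * (Z \<omega> - m)\<^sup>2)"
  proof (rule integral_mono[OF eint])
    fix \<omega> assume \<omega>: "\<omega> \<in> space M"
    have "exp \<bar>l * (Z \<omega> - m)\<bar> \<le> exp (2 * l * R)"
      using D[OF \<omega>] \<open>0 \<le> l\<close> mult_left_mono[OF D[OF \<omega>], of l] by (simp add: abs_mult)
    then have "(l * (Z \<omega> - m))\<^sup>2 * exp \<bar>l * (Z \<omega> - m)\<bar> \<le> (l * (Z \<omega> - m))\<^sup>2 * exp (2 * l * R)"
      by (rule mult_left_mono) simp
    with exp_le_quadratic_exp_abs[of "l * (Z \<omega> - m)"]
    show "exp (l * (Z \<omega> - m)) \<le> 1 + l * (Z \<omega> - m) + l\<^sup>2 * exp (2 * l * R) * (Z \<omega> - m)\<^sup>2"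
      by (simp add: power_mult_distrib mult_ac)
  qed (use Dint D2int in auto)
  also have "\<dots> = 1 + l\<^sup>2 * exp (2 * l * R) * expectation (\<lambda>\<omega>. (Z \<omega> - m)\<^sup>2)"
    using Dint D2int Zint by (simp add: prob_space m_def)
  also have "expectation (\<lambda>\<omega>. (Z \<omega> - m)\<^sup>2) = expectation (\<lambda>\<omega>. (Z \<omega>)\<^sup>2) - m\<^sup>2"
    using variance_eq[OF Zint Z2int] by (simp add: m_def)
  also have "1 + l\<^sup>2 * exp (2 * l * R) * (expectation (\<lambda>\<omega>. (Z \<omega>)\<^sup>2) - m\<^sup>2)
      \<le> 1 + l\<^sup>2 * exp (2 * l * R) * expectation (\<lambda>\<omega>. (Z \<omega>)\<^sup>2)"
    by (intro add_left_mono mult_left_mono) auto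
  also have "\<dots> \<le> exp (l\<^sup>2 * exp (2 * l * R) * expectation (\<lambda>\<omega>. (Z \<omega>)\<^sup>2))"
    by (rule exp_ge_add_one_self)
  finally have "expectation (\<lambda>\<omega>. exp (l * (Z \<omega> - m))) * exp (l * m)
      \<le> exp (l\<^sup>2 * exp (2 * l * R) * expectation (\<lambda>\<omega>. (Z \<omega>)\<^sup>2)) * exp (l * m)"
    by (rule mult_right_mono) simp
  moreover have "expectation (\<lambda>\<omega>. exp (l * (Z \<omega> - m))) * exp (l * m) = expectation (\<lambda>\<omega>. exp (l * Z \<omega>))"
    by (subst integral_mult_left_zero[symmetric]) (simp add: algebra_simps flip: exp_add)
  ultimately show ?thesis unfolding m_def by linarith
qed

text \<open>The sum is a measurable function of the block indexed by \<open>I\<close>, and disjoint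
  blocks of an independent family are independent.\<close>

lemma (in prob_space) indep_var_sum_banach:
  fixes X :: "'i \<Rightarrow> 'a \<Rightarrow> 'b::{banach, second_countable_topology}"
  assumes "i \<notin> I" "indep_vars (\<lambda>_. borel) X (insert i I)"
  shows "indep_var borel (\<lambda>\<omega>. \<Sum>j\<in>I. X j \<omega>) borel (X i)"
proof -
  have "indep_var borel ((\<lambda>f. \<Sum>j\<in>I. f j) \<circ> (\<lambda>\<omega>. restrict (\<lambda>j. X j \<omega>) I))
    borel ((\<lambda>f. f i) \<circ> (\<lambda>\<omega>. restrict (\<lambda>j. X j \<omega>) {i}))"
    using assms(1) by (intro indep_var_compose[OF indep_var_restrict[OF assms(2)]]) auto
  then show ?thesis by (simp add: comp_def cong: sum.cong)
qed

text \<open>Independence makes the joint law a product, so Fubini applies: \<open>A\<close> is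
  frozen while the expectation over \<open>B\<close> is taken.\<close>

lemma (in prob_space) indep_var_expectation_pair:
  fixes F :: "'b::{second_countable_topology} \<times> 'b \<Rightarrow> real"
  assumes ind: "indep_var borel A borel B"
    and F[measurable]: "F \<in> borel_measurable (borel \<Otimes>\<^sub>M borel)"
    and int: "integrable M (\<lambda>\<omega>. F (A \<omega>, B \<omega>))"
  shows "expectation (\<lambda>\<omega>. F (A \<omega>, B \<omega>)) = expectation (\<lambda>\<omega>. expectation (\<lambda>\<omega>'. F (A \<omega>, B \<omega>')))"
proof -
  have [measurable]: "A \<in> borel_measurable M" "B \<in> borel_measurable M"
    using indep_var_rv1[OF ind] indep_var_rv2[OF ind] by auto
  let ?A = "distr M borel A" and ?B = "distr M borel B"
  interpret A: prob_space ?A by (rule prob_space_distr) simp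
  interpret B: prob_space ?B by (rule prob_space_distr) simp
  interpret P: pair_prob_space ?A ?B ..
  have eq: "?A \<Otimes>\<^sub>M ?B = distr M (borel \<Otimes>\<^sub>M borel) (\<lambda>\<omega>. (A \<omega>, B \<omega>))"
    using ind by (simp add: indep_var_distribution_eq)
  have "integrable (?A \<Otimes>\<^sub>M ?B) F"
    unfolding eq by (subst integrable_distr_eq) (auto intro: int)
  then have "integral\<^sup>L (?A \<Otimes>\<^sub>M ?B) F = (\<integral>x. \<integral>y. F (x, y) \<partial>?B \<partial>?A)"
    by (rule P.integral_fst'[symmetric])
  also have "\<dots> = expectation (\<lambda>\<omega>. \<integral>y. F (A \<omega>, y) \<partial>?B)"
    by (rule integral_distr) (auto intro!: borel_measurable_lebesgue_integral)
  also have "\<dots> = expectation (\<lambda>\<omega>. expectation (\<lambda>\<omega>'. F (A \<omega>, B \<omega>')))"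
    by (intro Bochner_Integration.integral_cong refl integral_distr) auto
  finally show ?thesis
    unfolding eq by (subst (asm) integral_distr) auto
qed

lemma borel_measurable_lipschitz:
  fixes f :: "'b::real_normed_vector \<Rightarrow> real"
  assumes "\<And>x y. \<bar>f x - f y\<bar> \<le> norm (x - y)"
  shows "f \<in> borel_measurable borel"
proof (rule borel_measurable_continuous_onI)
  show "continuous_on UNIV f"
    unfolding continuous_on_iff dist_norm real_norm_def
    using assms by (meson le_less_trans)
qed

text \<open>Induction on \<open>I\<close> with \<open>f\<close> left general. Averaging out the
  newest summand replaces \<open>f\<close> by \<open>g\<close>, which is again 1-Lipschitz, at the
  cost of one factor \<open>exp (l\<^sup>2 * exp (2 * l * R) * v)\<close>; the induction hypothesis
  is then used for \<open>g\<close>.\<close>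

lemma (in prob_space) expectation_exp_lipschitz_sum_le:
  fixes Y :: "'i \<Rightarrow> 'a \<Rightarrow> 'b::{banach, second_countable_topology}"
  assumes "finite I" and "indep_vars (\<lambda>_. borel) Y I"
    and "\<And>i \<omega>. i \<in> I \<Longrightarrow> norm (Y i \<omega>) \<le> R"
    and "\<And>i. i \<in> I \<Longrightarrow> expectation (\<lambda>\<omega>. (norm (Y i \<omega>))\<^sup>2) \<le> v"
    and "0 \<le> l" and "\<And>x y. \<bar>f x - f y\<bar> \<le> norm (x - y)"
  shows "expectation (\<lambda>\<omega>. exp (l * f (\<Sum>i\<in>I. Y i \<omega>)))
    \<le> exp (card I * (l\<^sup>2 * exp (2 * l * R) * v)) * exp (l * expectation (\<lambda>\<omega>. f (\<Sum>i\<in>I. Y i \<omega>)))"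
  using assms
proof (induction I arbitrary: f rule: finite_induct)
  case empty
  then show ?case by (simp add: prob_space)
next
  case (insert i I)
  let ?c = "l\<^sup>2 * exp (2 * l * R) * v"
  let ?U = "\<lambda>\<omega>. \<Sum>j\<in>I. Y j \<omega>"
  define g where "g x = expectation (\<lambda>\<omega>. f (x + Y i \<omega>))" for x
  have Yi[measurable]: "j \<in> insert i I \<Longrightarrow> Y j \<in> borel_measurable M" for j
    using insert.prems(1) by (auto simp: indep_vars_def)
  have iY[measurable]: "Y i \<in> borel_measurable M" by simp
  have U[measurable]: "?U \<in> borel_measurable M" by simp
  have lip: "\<bar>f x - f y\<bar> \<le> norm (x - y)" for x y by fact
  have [measurable]: "f \<in> borel_measurable borel"
    using lip by (rule borel_measurable_lipschitz)
  have R: "norm (Y j \<omega>) \<le> R" if "j \<in> insert i I" for j \<omega>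
    using insert.prems(2) that by auto
  have "0 \<le> R" using R[of i] norm_ge_zero order_trans by blast
  have bnd: "\<bar>f (x + Y i \<omega>) - f x\<bar> \<le> norm (Y i \<omega>)" for x \<omega>
    using lip[of "x + Y i \<omega>" x] by simp
  have fint: "integrable M (\<lambda>\<omega>. f (x + Y i \<omega>))" for x
  proof (rule integrable_const_bound[where B="\<bar>f x\<bar> + R"])
    show "AE \<omega> in M. norm (f (x + Y i \<omega>)) \<le> \<bar>f x\<bar> + R"
      using bnd[of x] R[of i] by (intro AE_I2) (smt (verit) insertI1 real_norm_def)
  qed simp
  have glip: "\<bar>g x - g y\<bar> \<le> norm (x - y)" for x y
  proof -
    have "\<bar>g x - g y\<bar> = \<bar>expectation (\<lambda>\<omega>. f (x + Y i \<omega>) - f (y + Y i \<omega>))\<bar>"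
      by (simp add: g_def fint)
    also have "\<dots> \<le> expectation (\<lambda>\<omega>. \<bar>f (x + Y i \<omega>) - f (y + Y i \<omega>)\<bar>)"
      by (rule integral_abs_bound)
    also have "\<dots> \<le> norm (x - y)"
      by (intro integral_le_const integrable_abs Bochner_Integration.integrable_diff fint)
         (metis (no_types, lifting) AE_I2 add_diff_cancel_right lip)
    finally show ?thesis .
  qed
  have [measurable]: "g \<in> borel_measurable borel"
    using glip by (rule borel_measurable_lipschitz)
  have Ubd: "norm (?U \<omega>) \<le> card I * R" for \<omega>
    using R by (intro sum_norm_bound) auto
  have fU: "\<bar>f (?U \<omega> + Y i \<omega>')\<bar> \<le> \<bar>f 0\<bar> + card I * R + R" for \<omega> \<omega>'
    using lip[of "?U \<omega> + Y i \<omega>'" 0] norm_triangle_ineq[of "?U \<omega>" "Y i \<omega>'"] Ubd[of \<omega>] R[of i \<omega>']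
    by auto
  have ind: "indep_var borel ?U borel (Y i)"
    using insert.hyps insert.prems(1) by (intro indep_var_sum_banach)
  \<comment> \<open>With \<open>x\<close> frozen, the increment \<open>?Z\<close> is bounded by
    \<open>norm (Y i \<omega>)\<close>, so its size is at most \<open>R\<close> and its second
    moment at most \<open>v\<close>.\<close>
  have one: "expectation (\<lambda>\<omega>. exp (l * f (x + Y i \<omega>))) \<le> exp ?c * exp (l * g x)" for x
  proof -
    let ?Z = "\<lambda>\<omega>. f (x + Y i \<omega>) - f x"
    have "(?Z \<omega>)\<^sup>2 \<le> (norm (Y i \<omega>))\<^sup>2" for \<omega>
      using power_mono[OF bnd[of x \<omega>], of 2] by simp
    moreover have Y2: "integrable M (\<lambda>\<omega>. (norm (Y i \<omega>))\<^sup>2)"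
      by (rule integrable_const_bound[where B="R\<^sup>2"]) (auto intro!: power_mono R)
    moreover have "integrable M (\<lambda>\<omega>. (?Z \<omega>)\<^sup>2)"
      using calculation by (intro Bochner_Integration.integrable_bound[OF Y2]) auto
    ultimately have "expectation (\<lambda>\<omega>. (?Z \<omega>)\<^sup>2) \<le> expectation (\<lambda>\<omega>. (norm (Y i \<omega>))\<^sup>2)"
      by (intro integral_mono) auto
    also have "\<dots> \<le> v" using insert.prems(3) by simp
    finally have "exp (l\<^sup>2 * exp (2 * l * R) * expectation (\<lambda>\<omega>. (?Z \<omega>)\<^sup>2)) \<le> exp ?c"
      by (simp add: mult_left_mono)
    moreover have "expectation (\<lambda>\<omega>. exp (l * ?Z \<omega>))
      \<le> exp (l\<^sup>2 * exp (2 * l * R) * expectation (\<lambda>\<omega>. (?Z \<omega>)\<^sup>2)) * exp (l * expectation ?Z)"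
      using bnd[of x] R[of i] insert.prems(4)
      by (intro expectation_exp_centered_le) (auto intro: order_trans)
    ultimately have "expectation (\<lambda>\<omega>. exp (l * ?Z \<omega>)) \<le> exp ?c * exp (l * expectation ?Z)"
      by (smt (verit) exp_gt_zero mult_right_mono)
    then have "exp (l * f x) * expectation (\<lambda>\<omega>. exp (l * ?Z \<omega>))
        \<le> exp (l * f x) * (exp ?c * exp (l * expectation ?Z))"
      by (rule mult_left_mono) simp
    moreover have "exp (l * f x) * expectation (\<lambda>\<omega>. exp (l * ?Z \<omega>)) = expectation (\<lambda>\<omega>. exp (l * f (x + Y i \<omega>)))"
      by (subst integral_mult_right_zero[symmetric]) (simp add: algebra_simps flip: exp_add)
    moreover have "expectation ?Z = g x - f x"
      by (simp add: g_def fint prob_space)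
    ultimately show ?thesis
      by (simp add: algebra_simps flip: exp_add)
  qed
  have gb: "\<bar>g (?U \<omega>)\<bar> \<le> \<bar>f 0\<bar> + card I * R + R" for \<omega>
  proof -
    have "\<bar>g (?U \<omega>)\<bar> \<le> expectation (\<lambda>\<omega>'. \<bar>f (?U \<omega> + Y i \<omega>')\<bar>)"
      unfolding g_def by (rule integral_abs_bound)
    also have "\<dots> \<le> \<bar>f 0\<bar> + card I * R + R"
      using fU by (intro integral_le_const integrable_abs fint) auto
    finally show ?thesis .
  qed
  have eb: "exp (l * y) \<le> exp (l * (\<bar>f 0\<bar> + card I * R + R))"
    if "\<bar>y\<bar> \<le> \<bar>f 0\<bar> + card I * R + R" for y
    using that insert.prems(4) by (auto intro!: mult_left_mono)
  have intE: "integrable M (\<lambda>\<omega>. exp (l * f (?U \<omega> + Y i \<omega>)))"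
    using fU eb by (intro integrable_const_bound[where B="exp (l * (\<bar>f 0\<bar> + card I * R + R))"]) auto
  have intf: "integrable M (\<lambda>\<omega>. f (?U \<omega> + Y i \<omega>))"
    using fU by (intro integrable_const_bound[where B="\<bar>f 0\<bar> + card I * R + R"]) auto
  have intg: "integrable M (\<lambda>\<omega>. exp (l * g (?U \<omega>)))"
    using gb eb by (intro integrable_const_bound[where B="exp (l * (\<bar>f 0\<bar> + card I * R + R))"]) auto
  have dbl: "\<bar>expectation (\<lambda>\<omega>'. exp (l * f (?U \<omega> + Y i \<omega>')))\<bar> \<le> exp ?c * exp (l * (\<bar>f 0\<bar> + card I * R + R))" for \<omega>
    using one[of "?U \<omega>"] eb[OF gb[of \<omega>]]
    by (smt (verit) exp_gt_zero mult_left_mono integral_nonneg_AE AE_I2)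
  have intG: "integrable M (\<lambda>\<omega>. expectation (\<lambda>\<omega>'. exp (l * f (?U \<omega> + Y i \<omega>'))))"
  proof (rule integrable_const_bound)
    show "AE \<omega> in M. norm (expectation (\<lambda>\<omega>'. exp (l * f (?U \<omega> + Y i \<omega>'))))
        \<le> exp ?c * exp (l * (\<bar>f 0\<bar> + card I * R + R))"
      unfolding real_norm_def by (intro AE_I2 dbl)
  qed simp
  have "expectation (\<lambda>\<omega>. exp (l * f (?U \<omega> + Y i \<omega>)))
      = expectation (\<lambda>\<omega>. expectation (\<lambda>\<omega>'. exp (l * f (?U \<omega> + Y i \<omega>'))))"
    using indep_var_expectation_pair[OF ind, of "\<lambda>(x, y). exp (l * f (x + y))"] intE by simp
  also have "\<dots> \<le> expectation (\<lambda>\<omega>. exp ?c * exp (l * g (?U \<omega>)))"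
    using one intg by (intro integral_mono intG integrable_mult_right)
  also have "\<dots> = exp ?c * expectation (\<lambda>\<omega>. exp (l * g (?U \<omega>)))"
    by simp
  also have "\<dots> \<le> exp ?c * (exp (card I * ?c) * exp (l * expectation (\<lambda>\<omega>. g (?U \<omega>))))"
    using insert.prems indep_vars_subset[of "\<lambda>_. borel" Y "insert i I" I] glip
    by (intro mult_left_mono insert.IH) auto
  \<comment> \<open>Fubini without the exponential: the mean of \<open>g\<close> at the partial sum
    is the mean of \<open>f\<close> at the full sum, so the centring terms match.\<close>
  also have "expectation (\<lambda>\<omega>. g (?U \<omega>)) = expectation (\<lambda>\<omega>. f (?U \<omega> + Y i \<omega>))"
    unfolding g_def
    using indep_var_expectation_pair[OF ind, of "\<lambda>(x, y). f (x + y)"] intf by simp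
  also have "exp ?c * (exp (card I * ?c) * exp (l * expectation (\<lambda>\<omega>. f (?U \<omega> + Y i \<omega>))))
     = exp (card (insert i I) * ?c) * exp (l * expectation (\<lambda>\<omega>. f (?U \<omega> + Y i \<omega>)))"
    using insert.hyps by (simp add: algebra_simps flip: exp_add)
  finally show ?case
    using insert.hyps by (simp add: add.commute)
qed

text \<open>Markov's inequality for the exponential moment. Since \<open>f\<close> is any
  1-Lipschitz function, \<open>norm\<close> and its negative give deviations of the norm to either
  side of its mean.\<close>

lemma (in prob_space) prob_lipschitz_sum_deviation_le:
  fixes Y :: "'i \<Rightarrow> 'a \<Rightarrow> 'b::{banach, second_countable_topology}"
  assumes "finite I" and ind: "indep_vars (\<lambda>_. borel) Y I"
    and R: "\<And>i \<omega>. i \<in> I \<Longrightarrow> norm (Y i \<omega>) \<le> R"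
    and v: "\<And>i. i \<in> I \<Longrightarrow> expectation (\<lambda>\<omega>. (norm (Y i \<omega>))\<^sup>2) \<le> v"
    and "0 < l" and lip: "\<And>x y. \<bar>f x - f y\<bar> \<le> norm (x - y)"
  defines "m \<equiv> expectation (\<lambda>\<omega>. f (\<Sum>i\<in>I. Y i \<omega>))"
  shows "prob {\<omega> \<in> space M. m + x \<le> f (\<Sum>i\<in>I. Y i \<omega>)}
    \<le> exp (card I * (l\<^sup>2 * exp (2 * l * R) * v) - l * x)"
proof -
  let ?U = "\<lambda>\<omega>. \<Sum>j\<in>I. Y j \<omega>"
  have Yi[measurable]: "j \<in> I \<Longrightarrow> Y j \<in> borel_measurable M" for j
    using ind by (auto simp: indep_vars_def)
  have U[measurable]: "?U \<in> borel_measurable M" by simp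
  have [measurable]: "f \<in> borel_measurable borel"
    using lip by (rule borel_measurable_lipschitz)
  have Ubd: "norm (?U \<omega>) \<le> card I * R" for \<omega>
    using R by (intro sum_norm_bound) auto
  have fU: "f (?U \<omega>) \<le> \<bar>f 0\<bar> + card I * R" for \<omega>
    using lip[of "?U \<omega>" 0] Ubd[of \<omega>] by auto
  have int: "integrable M (\<lambda>\<omega>. exp (l * f (?U \<omega>)))"
    using fU \<open>0 < l\<close> by (intro integrable_const_bound[where B="exp (l * (\<bar>f 0\<bar> + card I * R))"]) auto
  have "prob {\<omega> \<in> space M. m + x \<le> f (?U \<omega>)} = prob {\<omega> \<in> space M. exp (l * (m + x)) \<le> exp (l * f (?U \<omega>))}"
    using \<open>0 < l\<close> by simp
  also have "\<dots> \<le> expectation (\<lambda>\<omega>. exp (l * f (?U \<omega>))) / exp (l * (m + x))"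
    by (rule integral_Markov_inequality_measure[where A="{}"]) (use int in auto)
  also have "\<dots> \<le> exp (card I * (l\<^sup>2 * exp (2 * l * R) * v)) * exp (l * m) / exp (l * (m + x))"
    unfolding m_def using assms by (intro divide_right_mono expectation_exp_lipschitz_sum_le) auto
  also have "\<dots> = exp (card I * (l\<^sup>2 * exp (2 * l * R) * v) - l * x)"
    by (simp add: algebra_simps exp_diff exp_add)
  finally show ?thesis .
qed

section \<open>Sums under the weak law\<close>

definition norm_trunc :: "real \<Rightarrow> 'b \<Rightarrow> 'b::real_normed_vector" where
  "norm_trunc \<tau> x = (if norm x \<le> \<tau> then x else 0)"

lemma borel_measurable_norm_trunc [measurable (raw)]:
  fixes f :: "'a \<Rightarrow> 'b::{banach, second_countable_topology}"
  assumes [measurable]: "f \<in> borel_measurable N"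
  shows "(\<lambda>x. norm_trunc \<tau> (f x)) \<in> borel_measurable N"
  unfolding norm_trunc_def by measurable

lemma norm_norm_trunc_le: "0 \<le> \<tau> \<Longrightarrow> norm (norm_trunc \<tau> x) \<le> \<tau>"
  by (simp add: norm_trunc_def)

text \<open>Where \<open>x\<close> is kept, the squared norm splits into powers \<open>2 - q\<close>
  and \<open>q\<close>, and the first is bounded through the level. Thus a moment of order
  \<open>q\<close> controls the truncated second moment.\<close>

lemma norm_norm_trunc_square_le:
  assumes "0 < q" "q < 2" "0 < \<tau>"
  shows "(norm (norm_trunc \<tau> x))\<^sup>2 \<le> \<tau> powr (2 - q) * norm x powr q"
proof (cases "x = 0 \<or> norm x > \<tau>")
  case False
  then have "(norm x)\<^sup>2 = norm x powr (2 - q) * norm x powr q"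
    by (simp flip: powr_add)
  also have "\<dots> \<le> \<tau> powr (2 - q) * norm x powr q"
    using False assms by (intro mult_right_mono powr_mono2) auto
  finally show ?thesis using False by (simp add: norm_trunc_def)
qed (auto simp: norm_trunc_def)

lemma nat_floor_bounds:
  assumes "1 \<le> (x :: real)"
  shows "real (nat \<lfloor>x\<rfloor>) \<le> x" "x \<le> 2 * real (nat \<lfloor>x\<rfloor>)"
proof -
  have "1 \<le> \<lfloor>x\<rfloor>" using assms by simp
  then have "real (nat \<lfloor>x\<rfloor>) = \<lfloor>x\<rfloor>" "1 \<le> real_of_int \<lfloor>x\<rfloor>" by simp_all
  then show "real (nat \<lfloor>x\<rfloor>) \<le> x" "x \<le> 2 * real (nat \<lfloor>x\<rfloor>)" by linarith+
qed

section \<open>Independent, identically distributed summands obeying the weak law\<close>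

locale iid_weak_law = prob_space M
  for M :: "'a measure" +
  fixes X :: "nat \<Rightarrow> 'a \<Rightarrow> 'b::{banach, second_countable_topology}" and p :: real
  assumes p: "0 < p" "p < 2"
    and meas [measurable]: "\<And>i. X i \<in> borel_measurable M"
    and indep: "indep_vars (\<lambda>_. borel) X UNIV"
    and ident: "\<And>i. distr M borel (X i) = distr M borel (X 0)"
    and conv: "\<And>\<epsilon>. \<epsilon> > 0 \<Longrightarrow>
      (\<lambda>n. prob {\<omega> \<in> space M. norm (\<Sum>i\<in>{1..n}. X i \<omega>) / real n powr (1 / p) > \<epsilon>}) \<longlonglongrightarrow> 0"
begin

definition S :: "nat \<Rightarrow> 'a \<Rightarrow> 'b" where
  "S n \<omega> = (\<Sum>i\<in>{1..n}. X i \<omega>)"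

definition sum_tail :: "nat \<Rightarrow> real \<Rightarrow> real" where
  "sum_tail n x = prob {\<omega> \<in> space M. x < norm (S n \<omega>)}"

text \<open>\<open>X 0\<close> stands for the common law; it is not among the summands of
  \<open>S n\<close>, which are indexed from 1.\<close>

definition tail :: "real \<Rightarrow> real" where
  "tail t = prob {\<omega> \<in> space M. t < norm (X 0 \<omega>)}"

lemma measurable_S [measurable]: "S n \<in> borel_measurable M"
  unfolding S_def by measurable

lemma tail_nonneg: "0 \<le> tail t" and tail_le_1: "tail t \<le> 1"
  by (simp_all add: tail_def)

lemma tail_antimono: "s \<le> t \<Longrightarrow> tail t \<le> tail s"
  unfolding tail_def by (intro finite_measure_mono) auto

lemma prob_ident:
  assumes "A \<in> sets borel"
  shows "prob {\<omega> \<in> space M. X i \<omega> \<in> A} = prob {\<omega> \<in> space M. X 0 \<omega> \<in> A}"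
proof -
  have "measure (distr M borel (X i)) A = measure (distr M borel (X 0)) A"
    by (simp add: ident[of i])
  then show ?thesis
    using assms by (simp add: measure_distr vimage_def Int_def conj_commute)
qed

lemma prob_norm_gt: "prob {\<omega> \<in> space M. t < norm (X i \<omega>)} = tail t"
  using prob_ident[of "{x. t < norm x}" i] by (simp add: tail_def)

lemma expectation_ident:
  fixes f :: "'b \<Rightarrow> real"
  assumes [measurable]: "f \<in> borel_measurable borel"
  shows "expectation (\<lambda>\<omega>. f (X i \<omega>)) = expectation (\<lambda>\<omega>. f (X 0 \<omega>))"
proof -
  have "expectation (\<lambda>\<omega>. f (X i \<omega>)) = integral\<^sup>L (distr M borel (X i)) f"
    by (rule integral_distr[symmetric]) auto
  also have "\<dots> = integral\<^sup>L (distr M borel (X 0)) f"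
    by (simp add: ident[of i])
  also have "\<dots> = expectation (\<lambda>\<omega>. f (X 0 \<omega>))"
    by (rule integral_distr) auto
  finally show ?thesis .
qed

lemma tail_tendsto_0: "(tail \<longlongrightarrow> 0) at_top"
proof -
  have "((\<lambda>t. measure (distr M borel (\<lambda>\<omega>. norm (X 0 \<omega>))) {..t}) \<longlongrightarrow> 1) at_top"
    by (intro real_distribution.cdf_lim_at_top_prob[unfolded cdf_def])
       (auto intro!: real_distribution_distr)
  moreover have "measure (distr M borel (\<lambda>\<omega>. norm (X 0 \<omega>))) {..t} = 1 - tail t" for t
  proof -
    have "measure (distr M borel (\<lambda>\<omega>. norm (X 0 \<omega>))) {..t} = prob {\<omega> \<in> space M. norm (X 0 \<omega>) \<le> t}"
      by (subst measure_distr) (auto intro!: arg_cong[where f=prob])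
    also have "\<dots> = 1 - prob {\<omega> \<in> space M. \<not> norm (X 0 \<omega>) \<le> t}"
      by (subst prob_neg) auto
    finally show ?thesis by (simp add: tail_def not_le)
  qed
  ultimately have "((\<lambda>t. 1 - (1 - tail t)) \<longlongrightarrow> 1 - 1) at_top"
    by (intro tendsto_diff) auto
  then show ?thesis by simp
qed

section \<open>Consequences of the weak law for a single summand\<close>

lemma filterlim_scaled_root_at_top: "c > 0 \<Longrightarrow> filterlim (\<lambda>n::nat. c * real n powr (1 / p)) at_top sequentially"
  using p by real_asymp

lemma sum_tail_tendsto_0:
  assumes "s > 0"
  shows "(\<lambda>n. sum_tail n (s * real n powr (1 / p))) \<longlonglongrightarrow> 0"
proof (rule Lim_transform_eventually[OF conv[OF assms]])
  show "\<forall>\<^sub>F n in sequentially. prob {\<omega> \<in> space M. norm (\<Sum>i\<in>{1..n}. X i \<omega>) / real n powr (1 / p) > s}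
      = sum_tail n (s * real n powr (1 / p))"
    using eventually_gt_at_top[of 0]
    by eventually_elim (simp add: sum_tail_def S_def pos_less_divide_eq)
qed

text \<open>A lower bound by the disjoint events that exactly one of the first \<open>k\<close> summands is large
  while the others together are small.\<close>
lemma sum_tail_ge_first_terms:
  fixes k n :: nat
  assumes "k \<le> n" and k: "k * tail (2 * x) \<le> 1 / 2"
    and small: "sum_tail n (x / 2) + tail (x / 2) \<le> 1 / 4"
  shows "k * tail (2 * x) / 4 \<le> sum_tail n x"
proof -
  define A where "A i = {\<omega> \<in> space M. 2 * x < norm (X i \<omega>)}" for i
  define B where "B i = {\<omega> \<in> space M. norm (S n \<omega> - X i \<omega>) \<le> x}" for i
  \<comment> \<open>Discarding the overlaps makes these sets disjoint; by independence each overlap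
    costs only the square of \<open>tail (2 * x)\<close>.\<close>
  define D where "D i = (A i \<inter> B i) - (\<Union>j\<in>{1..k} - {i}. A i \<inter> A j)" for i
  have [measurable]: "A i \<in> sets M" "B i \<in> sets M" for i
    by (simp_all add: A_def B_def)
  then have [measurable]: "D i \<in> sets M" for i
    unfolding D_def by (intro sets.Diff sets.Int sets.finite_UN) auto
  have PA: "prob (A i) = tail (2 * x)" for i
    by (simp add: A_def prob_norm_gt)
  \<comment> \<open>If \<open>S n\<close> and \<open>X i\<close> both have norm at most
    \<open>x / 2\<close>, their difference has norm at most \<open>x\<close>.\<close>
  have PB: "3 / 4 \<le> prob (B i)" for i
  proof -
    have "1 - prob (B i) = prob (space M - B i)"
      by (simp add: prob_compl)
    also have "\<dots> \<le> prob ({\<omega> \<in> space M. x / 2 < norm (S n \<omega>)} \<union> {\<omega> \<in> space M. x / 2 < norm (X i \<omega>)})"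
    proof (intro finite_measure_mono subsetI)
      fix \<omega> assume "\<omega> \<in> space M - B i"
      then show "\<omega> \<in> {\<omega> \<in> space M. x / 2 < norm (S n \<omega>)} \<union> {\<omega> \<in> space M. x / 2 < norm (X i \<omega>)}"
        using norm_triangle_ineq4[of "S n \<omega>" "X i \<omega>"] by (auto simp: B_def)
    qed simp
    also have "\<dots> \<le> sum_tail n (x / 2) + tail (x / 2)"
      unfolding sum_tail_def by (subst prob_norm_gt[of _ i, symmetric]) (intro measure_Un_le; simp)
    finally show ?thesis using small by linarith
  qed
  have AA: "prob (A i \<inter> A j) = tail (2 * x) * tail (2 * x)" if "i \<noteq> j" for i j
  proof -
    \<comment> \<open>The block \<open>{j}\<close> has sum \<open>X j\<close>, so independence of a
      block sum and a further variable gives pairwise independence.\<close>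
    have "indep_vars (\<lambda>_. borel) X (insert i {j})"
      using indep_vars_subset[OF indep] by blast
    from indep_varD[OF indep_var_sum_banach[OF _ this], of "{y. 2 * x < norm y}" "{y. 2 * x < norm y}"]
    have "prob (A i \<inter> A j) = prob (A j) * prob (A i)"
      using that by (simp add: A_def vimage_def Int_def conj_ac cong: conj_cong)
    then show ?thesis by (simp add: PA)
  qed
  have AB: "prob (A i \<inter> B i) = tail (2 * x) * prob (B i)" if i: "i \<in> {1..n}" for i
  proof -
    have "indep_vars (\<lambda>_. borel) X (insert i ({1..n} - {i}))"
      using indep_vars_subset[OF indep] by blast
    moreover have "(\<Sum>j\<in>{1..n} - {i}. X j \<omega>) = S n \<omega> - X i \<omega>" for \<omega>
      using i by (simp add: S_def sum_diff1)
    ultimately have "indep_var borel (\<lambda>\<omega>. S n \<omega> - X i \<omega>) borel (X i)"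
      using indep_var_sum_banach[of i "{1..n} - {i}" X] by simp
    from indep_varD[OF this, of "{y. norm y \<le> x}" "{y. 2 * x < norm y}"]
    have "prob (A i \<inter> B i) = prob (B i) * prob (A i)"
      by (simp add: A_def B_def vimage_def Int_def conj_ac cong: conj_cong)
    then show ?thesis by (simp add: PA)
  qed
  \<comment> \<open>Before the overlaps are removed the probability is at least \<open>3 / 4\<close>
    of \<open>tail (2 * x)\<close>. The condition on \<open>k\<close> limits the loss to one half of
    it, so one quarter is left.\<close>
  have PD: "tail (2 * x) / 4 \<le> prob (D i)" if i: "i \<in> {1..k}" for i
  proof -
    have "prob (\<Union>j\<in>{1..k} - {i}. A i \<inter> A j) \<le> (\<Sum>j\<in>{1..k} - {i}. prob (A i \<inter> A j))"
      by (intro finite_measure_subadditive_finite) auto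
    also have "\<dots> = (k - 1) * (tail (2 * x) * tail (2 * x))"
      using i by (simp add: AA)
    also have "\<dots> \<le> k * (tail (2 * x) * tail (2 * x))"
      by (intro mult_right_mono) auto
    also have "\<dots> \<le> 1 / 2 * tail (2 * x)"
      using mult_right_mono[OF k tail_nonneg[of "2 * x"]] by (simp add: mult_ac)
    finally have "prob (\<Union>j\<in>{1..k} - {i}. A i \<inter> A j) \<le> tail (2 * x) / 2" by simp
    moreover have "tail (2 * x) * (3 / 4) \<le> prob (A i \<inter> B i)"
      using i \<open>k \<le> n\<close> mult_left_mono[OF PB tail_nonneg] by (subst AB) auto
    moreover have "prob (A i \<inter> B i) - prob (\<Union>j\<in>{1..k} - {i}. A i \<inter> A j) \<le> prob (D i)"
      unfolding D_def
      by (intro measure_diff_le_measure_setdiff) (simp_all add: fmeasurable_eq_sets sets.finite_UN)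
    ultimately show ?thesis by linarith
  qed
  have "k * tail (2 * x) / 4 \<le> (\<Sum>i\<in>{1..k}. prob (D i))"
    using sum_mono[of "{1..k}" "\<lambda>_. tail (2 * x) / 4", OF PD] by simp
  also have "\<dots> = prob (\<Union>i\<in>{1..k}. D i)"
  proof (rule finite_measure_finite_Union[symmetric])
    show "disjoint_family_on D {1..k}"
      unfolding disjoint_family_on_def D_def by blast
  qed auto
  \<comment> \<open>On \<open>D i\<close> one summand has norm above \<open>2 * x\<close> while the
    rest of the sum has norm at most \<open>x\<close>.\<close>
  also have "\<dots> \<le> sum_tail n x"
    unfolding sum_tail_def
  proof (intro finite_measure_mono subsetI)
    fix \<omega> assume "\<omega> \<in> (\<Union>i\<in>{1..k}. D i)"
    then obtain i where "\<omega> \<in> A i" "\<omega> \<in> B i" by (auto simp: D_def)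
    then show "\<omega> \<in> {\<omega> \<in> space M. x < norm (S n \<omega>)}"
      using norm_triangle_ineq2[of "X i \<omega>" "X i \<omega> - S n \<omega>"] by (auto simp: A_def B_def norm_minus_commute)
  qed simp
  finally show ?thesis .
qed

text \<open>The first term vanishes by the weak law, the second because its level tends to infinity.
  This supplies the condition \<open>small\<close> of
  \<open>sum_tail_ge_first_terms\<close>.\<close>

lemma eventually_small:
  assumes "s > 0"
  shows "\<forall>\<^sub>F n in sequentially. sum_tail n (s * real n powr (1 / p) / 2) + tail (s * real n powr (1 / p) / 2) \<le> 1 / 4"
proof -
  have "(\<lambda>n. sum_tail n (s / 2 * real n powr (1 / p)) + tail (s / 2 * real n powr (1 / p))) \<longlonglongrightarrow> 0 + 0"
    using assms by (intro tendsto_add sum_tail_tendsto_0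
        filterlim_compose[OF tail_tendsto_0] filterlim_scaled_root_at_top) auto
  from order_tendstoD(2)[OF this, of "1 / 4"] show ?thesis
    by (auto elim!: eventually_mono)
qed

text \<open>If the product exceeded \<open>1 / 2\<close>, the lower bound could be applied to the
  first \<open>k\<close> summands only, with \<open>k\<close> times the tail between
  \<open>1 / 4\<close> and \<open>1 / 2\<close>. The sum would then have tail at least
  \<open>1 / 16\<close>, against the weak law.\<close>

lemma eventually_tail_le:
  assumes "s > 0"
  shows "\<forall>\<^sub>F n in sequentially. n * tail (2 * s * real n powr (1 / p)) \<le> 1 / 2"
proof -
  have "\<forall>\<^sub>F n in sequentially. sum_tail n (s * real n powr (1 / p)) < 1 / 16"
    using sum_tail_tendsto_0[OF assms] by (rule order_tendstoD) simp
  moreover have "\<forall>\<^sub>F n in sequentially. tail (2 * s * real n powr (1 / p)) < 1 / 2"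
    using assms by (intro order_tendstoD(2)[OF filterlim_compose[OF tail_tendsto_0]] filterlim_scaled_root_at_top) auto
  ultimately show ?thesis
    using eventually_small[OF assms]
  proof eventually_elim
    case (elim n)
    let ?x = "s * real n powr (1 / p)"
    let ?a = "tail (2 * ?x)"
    show ?case
    proof (rule ccontr)
      assume "\<not> ?thesis"
      then have n: "1 / 2 < n * ?a" by (simp add: mult.assoc)
      have a: "0 < ?a" using n tail_nonneg[of "2 * ?x"] by (cases "?a = 0") auto
      \<comment> \<open>Since \<open>?a < 1 / 2\<close>, the rounded number is at least 1 and
        rounding down at most halves it. Hence \<open>k * ?a\<close> lies between
        \<open>1 / 4\<close> and \<open>1 / 2\<close>.\<close>
      define k where "k = nat \<lfloor>1 / (2 * ?a)\<rfloor>"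
      have "1 \<le> 1 / (2 * ?a)" using elim(2) a by (simp add: field_simps)
      then have k: "real k \<le> 1 / (2 * ?a)" "1 / (2 * ?a) \<le> 2 * real k"
        unfolding k_def using nat_floor_bounds by blast+
      have "1 / (2 * ?a) < n" using n a by (simp add: field_simps)
      then have "k \<le> n" using k by linarith
      moreover have "k * ?a \<le> 1 / 2" "1 / 4 \<le> k * ?a" using k a by (simp_all add: field_simps)
      ultimately show False
        using sum_tail_ge_first_terms[of k n ?x] elim by simp
    qed
  qed
qed

text \<open>With \<open>n * tail\<close> now at most \<open>1 / 2\<close>, all \<open>n\<close>
  summands can be used in the lower bound.\<close>

lemma eventually_sum_tail_ge:
  assumes "s > 0"
  shows "\<forall>\<^sub>F n in sequentially. n * tail (2 * s * real n powr (1 / p)) / 4 \<le> sum_tail n (s * real n powr (1 / p))"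
  using eventually_tail_le[OF assms] eventually_small[OF assms]
proof eventually_elim
  case (elim n)
  then show ?case
    using sum_tail_ge_first_terms[of n n "s * real n powr (1 / p)"] by (simp add: mult.assoc)
qed

text \<open>The bound along the levels \<open>2 * real n powr (1 / p)\<close> extends to all
  \<open>t\<close> by monotonicity: \<open>t\<close> is compared with the level of
  \<open>n = nat \<lfloor>(t / 2) powr p\<rfloor>\<close>.\<close>

lemma tail_le_powr: "\<exists>C>0. \<forall>t>0. tail t \<le> C * t powr (- p)"
proof -
  obtain N where N: "\<And>n. n \<ge> N \<Longrightarrow> n * tail (2 * real n powr (1 / p)) \<le> 1 / 2"
    using eventually_tail_le[of 1] by (auto simp: eventually_sequentially)
  \<comment> \<open>If \<open>(t / 2) powr p < N + 1\<close>, this \<open>C\<close> exceeds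
    \<open>t powr p\<close> and \<open>tail t \<le> 1\<close> suffices. Otherwise rounding down
    leaves an index that is at least \<open>N\<close> and at least 1.\<close>
  define C where "C = 2 powr p * (real N + 1)"
  have "tail t \<le> C * t powr (- p)" if "t > 0" for t
  proof (cases "(t / 2) powr p < N + 1")
    case True
    then have "t powr p \<le> C"
      using that by (simp add: C_def powr_divide field_simps)
    then have "1 \<le> C * t powr (- p)"
      using that by (simp add: powr_minus field_simps)
    then show ?thesis using tail_le_1[of t] by linarith
  next
    case False
    define n where "n = nat \<lfloor>(t / 2) powr p\<rfloor>"
    have n: "real n \<le> (t / 2) powr p" "(t / 2) powr p \<le> 2 * real n"
      using False nat_floor_bounds[of "(t / 2) powr p"] by (auto simp: n_def)
    have "n \<ge> N" "n \<ge> 1"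
      using False by (auto simp: n_def le_nat_floor le_nat_iff le_floor_iff)
    note n = n this
    have "real n powr (1 / p) \<le> ((t / 2) powr p) powr (1 / p)"
      using n p by (intro powr_mono2) auto
    also have "\<dots> = t / 2" using that p by (simp add: powr_powr)
    finally have "tail t \<le> tail (2 * real n powr (1 / p))"
      by (intro tail_antimono) simp
    also have "\<dots> \<le> 1 / (2 * real n)"
      using N[OF n(3)] n(4) by (simp add: field_simps)
    also have "\<dots> \<le> 1 / ((t / 2) powr p)"
      using n that by (intro divide_left_mono) auto
    also have "\<dots> = 2 powr p * t powr (- p)"
      using that by (simp add: powr_divide powr_minus field_simps)
    also have "\<dots> \<le> C * t powr (- p)"
      unfolding C_def by (intro mult_right_mono) auto
    finally show ?thesis .
  qed
  moreover have "C > 0" by (simp add: C_def)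
  ultimately show ?thesis by blast
qed

text \<open>The expectation of the integer-valued majorant \<open>N\<close> is the sum of its tail
  probabilities. These are of order \<open>t powr (- p / q)\<close>, which is summable because
  \<open>q < p\<close>.\<close>

lemma integrable_norm_powr:
  assumes q: "0 < q" "q < p"
  shows "integrable M (\<lambda>\<omega>. norm (X 0 \<omega>) powr q)"
proof (rule integrableI_nonneg)
  obtain C where C: "C > 0" "\<And>t. t > 0 \<Longrightarrow> tail t \<le> C * t powr (- p)"
    using tail_le_powr by auto
  define N where "N \<omega> = nat \<lceil>norm (X 0 \<omega>) powr q\<rceil>" for \<omega>
  have N[measurable]: "N \<in> measurable M (count_space UNIV)"
    unfolding N_def by measurable
  define f where "f t = prob {\<omega> \<in> space M. t < N \<omega>}" for t
  have le: "norm (f t) \<le> C * real t powr (- p / q)" if t: "t \<ge> 1" for t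
  proof -
    have "f t \<le> tail (real t powr (1 / q))"
      unfolding f_def tail_def
    proof (intro finite_measure_mono subsetI)
      fix \<omega> assume "\<omega> \<in> {\<omega> \<in> space M. t < N \<omega>}"
      then have "\<omega> \<in> space M" and 1: "real t < norm (X 0 \<omega>) powr q"
        by (auto simp: N_def) linarith
      have "real t powr (1 / q) < (norm (X 0 \<omega>) powr q) powr (1 / q)"
        using 1 q by (intro powr_less_mono2) auto
      then show "\<omega> \<in> {\<omega> \<in> space M. real t powr (1 / q) < norm (X 0 \<omega>)}"
        using q \<open>\<omega> \<in> space M\<close> by (simp add: powr_powr)
    qed simp
    also have "\<dots> \<le> C * (real t powr (1 / q)) powr (- p)"
      using t by (intro C) simp
    finally show ?thesis by (simp add: powr_powr f_def)
  qed
  have "summable (\<lambda>t. C * real t powr (- p / q))"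
    using q by (intro summable_mult) (simp add: summable_real_powr_iff field_simps)
  then have "summable f"
    by (rule summable_comparison_test_ev[rotated]) (use le in \<open>auto simp: eventually_sequentially\<close>)
  have "(\<integral>\<^sup>+\<omega>. norm (X 0 \<omega>) powr q \<partial>M) \<le> (\<integral>\<^sup>+\<omega>. of_nat (N \<omega>) \<partial>M)"
    unfolding ennreal_of_nat_eq_real_of_nat
    by (intro nn_integral_mono ennreal_leI) (simp add: N_def)
  also have "\<dots> = (\<Sum>t. ennreal (f t))"
    by (simp add: nn_integral_nat_function f_def emeasure_eq_measure)
  also have "\<dots> < \<infinity>"
    using \<open>summable f\<close> by (subst suminf_ennreal2) (simp_all add: f_def)
  finally show "(\<integral>\<^sup>+\<omega>. norm (X 0 \<omega>) powr q \<partial>M) < \<infinity>" .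
qed auto

section \<open>Concentration of truncated sums\<close>

lemma truncated_second_moment_le:
  assumes q: "0 < q" "q < p"
  shows "\<exists>C>0. \<forall>\<tau>>0. \<forall>i. expectation (\<lambda>\<omega>. (norm (norm_trunc \<tau> (X i \<omega>)))\<^sup>2) \<le> C * \<tau> powr (2 - q)"
proof -
  \<comment> \<open>Only the moment of order \<open>q\<close> enters, so the bound is uniform in the
    level and in \<open>i\<close>. Adding 1 makes \<open>C\<close> positive even when that moment
    vanishes.\<close>
  define C where "C = expectation (\<lambda>\<omega>. norm (X 0 \<omega>) powr q) + 1"
  have "expectation (\<lambda>\<omega>. (norm (norm_trunc \<tau> (X i \<omega>)))\<^sup>2) \<le> C * \<tau> powr (2 - q)" if "\<tau> > 0" for \<tau> i
  proof -
    have "expectation (\<lambda>\<omega>. (norm (norm_trunc \<tau> (X i \<omega>)))\<^sup>2)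
        = expectation (\<lambda>\<omega>. (norm (norm_trunc \<tau> (X 0 \<omega>)))\<^sup>2)"
      using expectation_ident[of "\<lambda>x. (norm (norm_trunc \<tau> x))\<^sup>2" i] by simp
    also have "\<dots> \<le> expectation (\<lambda>\<omega>. \<tau> powr (2 - q) * norm (X 0 \<omega>) powr q)"
    proof (rule integral_mono)
      show "integrable M (\<lambda>\<omega>. (norm (norm_trunc \<tau> (X 0 \<omega>)))\<^sup>2)"
      proof (rule integrable_const_bound)
        show "AE \<omega> in M. norm ((norm (norm_trunc \<tau> (X 0 \<omega>)))\<^sup>2) \<le> \<tau>\<^sup>2"
          using that norm_norm_trunc_le[of \<tau>] by (intro AE_I2) (simp add: power_mono)
      qed simp
    qed (use that q p in \<open>auto intro: integrable_norm_powr norm_norm_trunc_square_le\<close>)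
    also have "\<dots> \<le> C * \<tau> powr (2 - q)"
      by (simp add: C_def algebra_simps)
    finally show ?thesis .
  qed
  moreover have "C > 0"
    unfolding C_def by (rule add_nonneg_pos) simp_all
  ultimately show ?thesis by blast
qed

text \<open>The two deviations are concentration for \<open>norm\<close> and for its negative. The
  third bound is a union bound: the truncated sum differs from \<open>S n\<close> only if some
  summand exceeds the level.\<close>

lemma truncated_sum_deviation_le:
  fixes n :: nat and x :: real
  assumes "0 \<le> \<tau>" "0 < l"
    and v: "\<And>i. expectation (\<lambda>\<omega>. (norm (norm_trunc \<tau> (X i \<omega>)))\<^sup>2) \<le> v"
  defines "U \<equiv> \<lambda>\<omega>. \<Sum>i\<in>{1..n}. norm_trunc \<tau> (X i \<omega>)"
  defines "m \<equiv> expectation (\<lambda>\<omega>. norm (U \<omega>))"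
    and "\<delta> \<equiv> exp (n * (l\<^sup>2 * exp (2 * l * \<tau>) * v) - l * x)"
  shows "prob {\<omega> \<in> space M. m + x \<le> norm (U \<omega>)} \<le> \<delta>"
    and "prob {\<omega> \<in> space M. norm (U \<omega>) \<le> m - x} \<le> \<delta>"
    and "prob {\<omega> \<in> space M. U \<omega> \<noteq> S n \<omega>} \<le> n * tail \<tau>"
proof -
  have "indep_vars (\<lambda>_. borel) (\<lambda>i \<omega>. norm_trunc \<tau> (X i \<omega>)) UNIV"
    by (rule indep_vars_compose2[OF indep]) simp
  then have ind: "indep_vars (\<lambda>_. borel) (\<lambda>i \<omega>. norm_trunc \<tau> (X i \<omega>)) {1..n}"
    by (rule indep_vars_subset) simp
  note dev = prob_lipschitz_sum_deviation_le[OF _ ind, of \<tau> v l _ x, OF _ norm_norm_trunc_le[OF \<open>0 \<le> \<tau>\<close>] v \<open>0 < l\<close>]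
  show "prob {\<omega> \<in> space M. m + x \<le> norm (U \<omega>)} \<le> \<delta>"
    using dev[of norm] by (simp add: U_def m_def \<delta>_def norm_triangle_ineq3)
  have "{\<omega> \<in> space M. norm (U \<omega>) \<le> m - x} = {\<omega> \<in> space M. expectation (\<lambda>\<omega>. - norm (U \<omega>)) + x \<le> - norm (U \<omega>)}"
    by (auto simp: m_def)
  then show "prob {\<omega> \<in> space M. norm (U \<omega>) \<le> m - x} \<le> \<delta>"
    using dev[of "\<lambda>y. - norm y"] by (simp add: U_def \<delta>_def norm_triangle_ineq3 abs_minus_commute)
  have "prob {\<omega> \<in> space M. U \<omega> \<noteq> S n \<omega>} \<le> prob (\<Union>i\<in>{1..n}. {\<omega> \<in> space M. \<tau> < norm (X i \<omega>)})"
  proof (intro finite_measure_mono subsetI)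
    fix \<omega> assume \<omega>: "\<omega> \<in> {\<omega> \<in> space M. U \<omega> \<noteq> S n \<omega>}"
    have "\<exists>i\<in>{1..n}. norm_trunc \<tau> (X i \<omega>) \<noteq> X i \<omega>"
    proof (rule ccontr)
      assume "\<not> ?thesis"
      then have "U \<omega> = S n \<omega>"
        unfolding U_def S_def by (intro sum.cong) auto
      with \<omega> show False by simp
    qed
    then obtain i where "i \<in> {1..n}" "norm_trunc \<tau> (X i \<omega>) \<noteq> X i \<omega>"
      by blast
    moreover have "\<tau> < norm (X i \<omega>)"
      using calculation by (simp add: norm_trunc_def split: if_splits)
    ultimately show "\<omega> \<in> (\<Union>i\<in>{1..n}. {\<omega> \<in> space M. \<tau> < norm (X i \<omega>)})"
      using \<omega> by blast
  qed simp
  also have "\<dots> \<le> (\<Sum>i\<in>{1..n}. prob {\<omega> \<in> space M. \<tau> < norm (X i \<omega>)})"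
    by (intro finite_measure_subadditive_finite) auto
  also have "\<dots> = n * tail \<tau>"
    by (simp add: prob_norm_gt)
  finally show "prob {\<omega> \<in> space M. U \<omega> \<noteq> S n \<omega>} \<le> n * tail \<tau>" .
qed

text \<open>Concentration holds only around the unknown mean norm \<open>m\<close>. The smallness of
  the tail of \<open>S n\<close> at \<open>x\<close> locates it: \<open>m \<le> 2 * x\<close>. A
  value of \<open>S n\<close> beyond \<open>4 * x\<close> is then a deviation of the truncated sum
  from \<open>m\<close>, unless some summand was cut.\<close>

lemma sum_tail_le_truncated:
  fixes n :: nat
  assumes "0 \<le> \<tau>" "0 < l" "0 < x"
    and v: "\<And>i. expectation (\<lambda>\<omega>. (norm (norm_trunc \<tau> (X i \<omega>)))\<^sup>2) \<le> v"
    and small: "sum_tail n x < 1 / 4"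
    and half: "exp (n * (l\<^sup>2 * exp (2 * l * \<tau>) * v) - l * x) \<le> 1 / 2"
  shows "sum_tail n (4 * x) \<le> 4 * n * tail \<tau> + exp (n * (l\<^sup>2 * exp (2 * l * \<tau>) * v) - l * x)"
proof (cases "1 / 4 \<le> n * tail \<tau>")
  \<comment> \<open>Here the right-hand side is at least 1; this case is the source of the factor
    4.\<close>
  case True
  have "sum_tail n (4 * x) \<le> 1" by (simp add: sum_tail_def)
  also have "\<dots> \<le> 4 * n * tail \<tau>" using True by simp
  finally show ?thesis by (simp add: add_increasing2)
next
  case False
  define U where "U \<omega> = (\<Sum>i\<in>{1..n}. norm_trunc \<tau> (X i \<omega>))" for \<omega>
  define m where "m = expectation (\<lambda>\<omega>. norm (U \<omega>))"
  define \<delta> where "\<delta> = exp (n * (l\<^sup>2 * exp (2 * l * \<tau>) * v) - l * x)"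
  have [measurable]: "U \<in> borel_measurable M" unfolding U_def by measurable
  note dev =
    truncated_sum_deviation_le(1)[OF assms(1,2) v, of n x, folded U_def, folded m_def \<delta>_def]
    truncated_sum_deviation_le(2)[OF assms(1,2) v, of n x, folded U_def, folded m_def \<delta>_def]
    truncated_sum_deviation_le(3)[OF assms(1,2) v, of n, folded U_def]
  \<comment> \<open>If \<open>m\<close> were larger, then \<open>m - x > x\<close> and three events
    would cover the space: the truncated norm is at most \<open>m - x\<close>, or \<open>S n\<close>
    exceeds \<open>x\<close>, or the two sums differ. Their probabilities add up to less than
    \<open>1 / 2 + 1 / 4 + 1 / 4\<close>.\<close>
  have "m \<le> 2 * x"
  proof (rule ccontr)
    assume "\<not> m \<le> 2 * x"
    then have "1 \<le> prob ({\<omega> \<in> space M. norm (U \<omega>) \<le> m - x} \<union> {\<omega> \<in> space M. x < norm (S n \<omega>)}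
        \<union> {\<omega> \<in> space M. U \<omega> \<noteq> S n \<omega>})"
      unfolding prob_space[symmetric] by (intro finite_measure_mono) auto
    also have "\<dots> \<le> prob {\<omega> \<in> space M. norm (U \<omega>) \<le> m - x} + prob {\<omega> \<in> space M. x < norm (S n \<omega>)}
        + prob {\<omega> \<in> space M. U \<omega> \<noteq> S n \<omega>}"
      by (intro order_trans[OF measure_Un_le] add_mono) (simp_all add: measure_Un_le)
    also have "\<dots> < 1"
      using dev(2,3) small half False by (simp add: sum_tail_def \<delta>_def)
    finally show False by simp
  qed
  \<comment> \<open>Uses \<open>m + x \<le> 3 * x < 4 * x\<close>.\<close>
  have "sum_tail n (4 * x) \<le> prob ({\<omega> \<in> space M. m + x \<le> norm (U \<omega>)} \<union> {\<omega> \<in> space M. U \<omega> \<noteq> S n \<omega>})"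
    unfolding sum_tail_def using \<open>m \<le> 2 * x\<close> \<open>0 < x\<close> by (intro finite_measure_mono) auto
  also have "\<dots> \<le> prob {\<omega> \<in> space M. m + x \<le> norm (U \<omega>)} + prob {\<omega> \<in> space M. U \<omega> \<noteq> S n \<omega>}"
    by (intro measure_Un_le) auto
  also have "\<dots> \<le> \<delta> + n * tail \<tau>"
    by (intro add_mono dev)
  also have "\<dots> \<le> 4 * n * tail \<tau> + \<delta>"
    using tail_nonneg[of \<tau>] by (simp add: mult_right_mono)
  finally show ?thesis by (simp add: \<delta>_def)
qed

text \<open>Truncating slightly below \<open>n powr (1 / p)\<close> makes the normalised variance of the truncated
  sum polynomially small, so its deviations decay faster than any power of \<open>n\<close>.\<close>
lemma eventually_sum_tail_le:
  assumes "s > 0" and \<kappa>: "0 < \<kappa>" "\<kappa> < 1 / p"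
  shows "\<forall>\<^sub>F n in sequentially. sum_tail n (s * real n powr (1 / p)) \<le> 4 * n * tail (real n powr \<kappa>) + real n powr (- K)"
proof -
  have "\<kappa> * (2 - p) < 1 / p * (2 - p)"
    using \<kappa> p by (intro mult_strict_right_mono) auto
  then have "2 - (2 / p - 1) / \<kappa> < p"
    using \<kappa> p by (simp add: field_simps)
  \<comment> \<open>The lower constraint on \<open>q\<close> says exactly that the exponent
    \<open>a\<close> below is positive; it is compatible with \<open>q < p\<close> because
    \<open>\<kappa> < 1 / p\<close>.\<close>
  then obtain q where q: "2 - (2 / p - 1) / \<kappa> < q" "0 < q" "q < p"
    using dense[of "max 0 (2 - (2 / p - 1) / \<kappa>)" p] p by auto
  \<comment> \<open>The variance bound for the truncated sum, divided by the square of
    \<open>n powr (1 / p)\<close>, is of order \<open>n powr (- a)\<close>.\<close>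
  define a where "a = 2 / p - 1 - \<kappa> * (2 - q)"
  have a: "a > 0"
    using q(1) \<kappa> by (simp add: a_def field_simps)
  define b where "b = 1 / p - \<kappa>"
  have b: "b > 0" using \<kappa> by (simp add: b_def)
  obtain C where C: "C > 0"
    "\<And>\<tau> i. \<tau> > 0 \<Longrightarrow> expectation (\<lambda>\<omega>. (norm (norm_trunc \<tau> (X i \<omega>)))\<^sup>2) \<le> C * \<tau> powr (2 - q)"
    using truncated_second_moment_le[OF q(2,3)] by blast
  \<comment> \<open>Chosen so that \<open>l n\<close> times the deviation
    \<open>s / 4 * real n powr (1 / p)\<close> equals
    \<open>(\<bar>K\<bar> + 1) * ln (real n)\<close>.\<close>
  define K' where "K' = 4 * (\<bar>K\<bar> + 1) / s"
  have K': "K' > 0" unfolding K'_def using assms(1) by auto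
  define l where "l n = K' * ln (real n) * real n powr (- (1 / p))" for n :: nat
  \<comment> \<open>The quadratic part of the exponent in the concentration bound. It tends to 0:
    the powers \<open>- a\<close> and \<open>- b\<close> beat the logarithms in \<open>l n\<close>,
    and the second keeps the inner exponential bounded.\<close>
  define e where "e n = n * ((l n)\<^sup>2 * exp (2 * l n * real n powr \<kappa>) * (C * (real n powr \<kappa>) powr (2 - q)))" for n :: nat
  have t1: "(\<lambda>n::nat. (ln (real n))\<^sup>2 * real n powr (- a)) \<longlonglongrightarrow> 0"
    using a by real_asymp
  have t2: "(\<lambda>n::nat. ln (real n) * real n powr (- b)) \<longlonglongrightarrow> 0"
    using b by real_asymp
  have "(\<lambda>n::nat. K'\<^sup>2 * C * ((ln (real n))\<^sup>2 * real n powr (- a)) * exp (2 * K' * (ln (real n) * real n powr (- b))))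
      \<longlonglongrightarrow> K'\<^sup>2 * C * 0 * exp (2 * K' * 0)"
    by (intro tendsto_intros t1 t2)
  moreover have "\<forall>\<^sub>F n in sequentially. K'\<^sup>2 * C * ((ln (real n))\<^sup>2 * real n powr (- a)) * exp (2 * K' * (ln (real n) * real n powr (- b))) = e n"
    using eventually_gt_at_top[of 0]
  proof eventually_elim
    case (elim n)
    have 1: "real n powr (- a) = real n * (real n powr (- (1 / p)))\<^sup>2 * (real n powr \<kappa>) powr (2 - q)"
    proof -
      have "real n * (real n powr (- (1 / p)))\<^sup>2 * (real n powr \<kappa>) powr (2 - q)
          = real n powr 1 * real n powr (2 * (- (1 / p))) * real n powr (\<kappa> * (2 - q))"
        using elim by (simp add: powr_powr power2_eq_square flip: powr_add)
      also have "\<dots> = real n powr (- a)"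
        by (simp only: powr_add[symmetric]) (simp add: a_def algebra_simps)
      finally show ?thesis by simp
    qed
    have 2: "real n powr (- b) = real n powr (- (1 / p)) * real n powr \<kappa>"
      by (simp add: b_def flip: powr_add)
    show ?case
      unfolding e_def l_def 1 2 by (simp add: power_mult_distrib mult_ac)
  qed
  ultimately have "e \<longlonglongrightarrow> 0"
    using Lim_transform_eventually by force
  then have "\<forall>\<^sub>F n in sequentially. e n < 1"
    by (rule order_tendstoD) simp
  moreover have "\<forall>\<^sub>F n::nat in sequentially. 2 \<le> ln (real n)"
    by real_asymp
  moreover have "\<forall>\<^sub>F n in sequentially. sum_tail n (s / 4 * real n powr (1 / p)) < 1 / 4"
    using assms(1) by (intro order_tendstoD(2)[OF sum_tail_tendsto_0]) auto
  ultimately show ?thesis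
    using eventually_gt_at_top[of 0]
  proof eventually_elim
    case (elim n)
    let ?x = "s / 4 * real n powr (1 / p)"
    have "0 < ln (real n)" using elim(2) by linarith
    then have lpos: "l n > 0" unfolding l_def using elim K' by (intro mult_pos_pos) simp_all
    have "l n * ?x = (\<bar>K\<bar> + 1) * ln (real n) * (real n powr (- (1 / p)) * real n powr (1 / p))"
      using assms(1) by (simp add: l_def K'_def)
    also have "\<dots> = (\<bar>K\<bar> + 1) * ln (real n)"
      using elim by (simp flip: powr_add)
    finally have lx: "l n * ?x = (\<bar>K\<bar> + 1) * ln (real n)" .
    \<comment> \<open>The spare \<open>ln (real n)\<close>, which is at least 2, absorbs
      \<open>e n < 1\<close>. What remains is at most \<open>- 1\<close>, as needed for
      \<open>half\<close>, and at most \<open>- K * ln (real n)\<close>.\<close>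
    have ex: "e n - l n * ?x \<le> 1 - ln (real n) - \<bar>K\<bar> * ln (real n)"
      using elim(1) unfolding lx by (simp add: algebra_simps)
    also have "\<dots> \<le> - 1"
      using elim(2) by (smt (verit) mult_nonneg_nonneg)
    finally have "exp (e n - l n * ?x) \<le> exp (- 1)" by simp
    also have "\<dots> \<le> 1 / 2"
      using exp_ge_add_one_self[of 1] by (simp add: exp_minus field_simps)
    finally have half: "exp (e n - l n * ?x) \<le> 1 / 2" .
    have "- \<bar>K\<bar> * ln (real n) \<le> - K * ln (real n)"
      using elim(2) by (intro mult_right_mono) auto
    then have "e n - l n * ?x \<le> - K * ln (real n)"
      using ex elim(2) by linarith
    then have "exp (e n - l n * ?x) \<le> exp (- K * ln (real n))"
      by simp
    also have "\<dots> = real n powr (- K)"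
      using elim by (simp add: powr_def)
    finally have pow: "exp (e n - l n * ?x) \<le> real n powr (- K)" .
    have "sum_tail n (4 * ?x) \<le> 4 * n * tail (real n powr \<kappa>) + exp (e n - l n * ?x)"
      unfolding e_def
      using assms(1) elim lpos C half[unfolded e_def] by (intro sum_tail_le_truncated) auto
    with pow show ?case by simp
  qed
qed

end

section \<open>Polynomial rates\<close>

text \<open>Turns comparisons of extended-real rates into real inequalities. For
  \<open>x \<le> 0\<close> the rate is \<open>-\<infinity>\<close> and both sides hold.\<close>

lemma elog_scaled_less_iff:
  assumes "0 < t"
  shows "ereal (1 / t) * elog x < ereal r \<longleftrightarrow> x < exp (r * t)"
proof (cases "x \<le> 0")
  case True
  then show ?thesis
    using assms exp_gt_zero[of "r * t"] by (simp add: elog_def) (meson exp_gt_zero le_less_trans)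
next
  case False
  then have "ln x < r * t \<longleftrightarrow> x < exp (r * t)"
    by (metis exp_less_cancel_iff exp_ln not_le)
  then show ?thesis
    using assms False by (simp add: elog_def field_simps)
qed

lemma less_elog_scaled_iff:
  assumes "0 < t"
  shows "ereal r < ereal (1 / t) * elog x \<longleftrightarrow> exp (r * t) < x"
proof (cases "x \<le> 0")
  case True
  then show ?thesis
    using assms exp_gt_zero[of "r * t"] by (auto simp: elog_def simp del: exp_gt_zero)
next
  case False
  then have "r * t < ln x \<longleftrightarrow> exp (r * t) < x"
    by (metis exp_less_cancel_iff exp_ln not_le)
  then show ?thesis
    using assms False by (simp add: elog_def field_simps)
qed

text \<open>The value is \<open>1 - \<beta> / p\<close>, with infinite \<open>\<beta>\<close>
  included. By density of the reals it suffices to compare \<open>G\<close> with real numbers on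
  either side, so infinities never enter the probability estimates.\<close>

lemma ereal_affine_eqI:
  fixes p :: real and \<beta> G :: ereal
  assumes "0 < p"
    and upper: "\<And>r r'. - \<beta> < ereal r \<Longrightarrow> 1 + r / p < r' \<Longrightarrow> G \<le> ereal r'"
    and lower: "\<And>r r'. ereal r < - \<beta> \<Longrightarrow> r' < 1 + r / p \<Longrightarrow> ereal r' \<le> G"
  shows "G = - (\<beta> - ereal p) / ereal p"
proof (rule antisym)
  show "G \<le> - (\<beta> - ereal p) / ereal p"
  proof (rule ccontr)
    assume "\<not> ?thesis"
    then obtain r' where r': "- (\<beta> - ereal p) / ereal p < ereal r'" "ereal r' < G"
      using ereal_dense2 by (auto simp: not_le)
    have "\<exists>r. - \<beta> < ereal r \<and> 1 + r / p < r'"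
    proof (cases \<beta>)
      case (real b)
      then have "- b < p * (r' - 1)"
        using r'(1) \<open>0 < p\<close> by (simp add: field_simps)
      then obtain r where "- b < r" "r < p * (r' - 1)"
        using dense by blast
      then show ?thesis
        using real \<open>0 < p\<close> by (intro exI[of _ r]) (simp add: field_simps)
    next
      case PInf
      \<comment> \<open>Any real \<open>r\<close> lies above \<open>- \<beta>\<close> here; this one
        gives \<open>1 + r / p = r' - 1\<close>.\<close>
      then show ?thesis
        using \<open>0 < p\<close> by (intro exI[of _ "p * (r' - 2)"]) (simp add: field_simps)
    qed (use r'(1) \<open>0 < p\<close> in simp)
    with upper r'(2) show False by (auto simp: not_le[symmetric])
  qed
next
  show "- (\<beta> - ereal p) / ereal p \<le> G"
  proof (rule ccontr)
    assume "\<not> ?thesis"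
    then obtain r' where r': "ereal r' < - (\<beta> - ereal p) / ereal p" "G < ereal r'"
      using ereal_dense2 by (auto simp: not_le)
    have "\<exists>r. ereal r < - \<beta> \<and> r' < 1 + r / p"
    proof (cases \<beta>)
      case (real b)
      then have "p * (r' - 1) < - b"
        using r'(1) \<open>0 < p\<close> by (simp add: field_simps)
      then obtain r where "p * (r' - 1) < r" "r < - b"
        using dense by blast
      then show ?thesis
        using real \<open>0 < p\<close> by (intro exI[of _ r]) (simp add: field_simps)
    next
      case MInf
      \<comment> \<open>Any real \<open>r\<close> lies below \<open>- \<beta>\<close> here; this one
        gives \<open>1 + r / p = 1 + r'\<close>.\<close>
      then show ?thesis
        using \<open>0 < p\<close> by (intro exI[of _ "p * r'"]) (simp add: field_simps)
    qed (use r'(1) \<open>0 < p\<close> in simp)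
    with lower r'(2) show False by (auto simp: not_le[symmetric])
  qed
qed

lemma ereal_affine_inj:
  fixes a b :: ereal
  assumes "- (a - ereal p) / ereal p = - (b - ereal p) / ereal p" "0 < p"
  shows "a = b"
  using assms by (cases a; cases b) (auto simp: field_simps)

context iid_weak_law
begin

section \<open>Transfer of power bounds from one summand to the sums\<close>

lemma sum_tail_le_1: "sum_tail n x \<le> 1"
  by (simp add: sum_tail_def)

text \<open>The main term \<open>4 * n * tail (real n powr \<kappa>)\<close> has order at most
  \<open>1 + \<kappa> * r\<close>, which is below \<open>r'\<close> for \<open>\<kappa>\<close> near
  \<open>1 / p\<close>. Allowing \<open>exp t\<close> and \<open>real n powr \<kappa>\<close> to
  differ by a bounded factor lets one statement serve both for \<open>t\<close> chosen from
  \<open>n\<close> and for \<open>n\<close> chosen from \<open>t\<close>.\<close>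

lemma sum_tail_less_transfer:
  assumes "0 < s" "r \<le> 0" "1 + r / p < r'"
  shows "\<exists>\<kappa>. 0 < \<kappa> \<and> \<kappa> < 1 / p \<and> (\<forall>\<^sub>F n in sequentially. \<forall>t. tail (exp t) < exp (r * t) \<longrightarrow>
    exp t \<le> real n powr \<kappa> \<longrightarrow> real n powr \<kappa> \<le> 2 powr \<kappa> * exp t \<longrightarrow>
    sum_tail n (s * real n powr (1 / p)) < real n powr r')"
proof -
  \<comment> \<open>For \<open>r < 0\<close> the last condition reads
    \<open>\<kappa> > (r' - 1) / r\<close>, and that quotient is below \<open>1 / p\<close> by
    assumption. For \<open>r = 0\<close> any admissible \<open>\<kappa>\<close> works.\<close>
  obtain \<kappa> where \<kappa>: "0 < \<kappa>" "\<kappa> < 1 / p" "1 + \<kappa> * r < r'"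
  proof (cases "r = 0")
    case True
    then show ?thesis using that[of "1 / (2 * p)"] assms p by (simp add: field_simps)
  next
    case False
    then have "(r' - 1) / r < 1 / p"
      using assms p by (simp add: field_simps)
    then obtain \<kappa> where "max 0 ((r' - 1) / r) < \<kappa>" "\<kappa> < 1 / p"
      using dense[of "max 0 ((r' - 1) / r)" "1 / p"] p by auto
    then show ?thesis using that[of \<kappa>] False assms by (simp add: field_simps)
  qed
  define c where "c = 4 * 2 powr (- \<kappa> * r)"
  have "(\<lambda>n::nat. c * real n powr (1 + \<kappa> * r - r')) \<longlonglongrightarrow> 0"
    by (rule tendsto_mult_right_zero) (use \<kappa> in real_asymp)
  then have "\<forall>\<^sub>F n in sequentially. c * real n powr (1 + \<kappa> * r - r') < 1 / 2"
    by (rule order_tendstoD) simp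
  moreover have "\<forall>\<^sub>F n::nat in sequentially. real n powr (- 1) < 1 / 2"
    by real_asymp
  \<comment> \<open>With this \<open>K\<close> the error is \<open>n powr (r' - 1)\<close>; it and
    the main term are each below half of \<open>n powr r'\<close>.\<close>
  moreover note eventually_sum_tail_le[OF assms(1) \<kappa>(1,2), of "1 - r'"] eventually_gt_at_top[of 0]
  ultimately have "\<forall>\<^sub>F n in sequentially. \<forall>t. tail (exp t) < exp (r * t) \<longrightarrow>
    exp t \<le> real n powr \<kappa> \<longrightarrow> real n powr \<kappa> \<le> 2 powr \<kappa> * exp t \<longrightarrow>
    sum_tail n (s * real n powr (1 / p)) < real n powr r'"
  proof (eventually_elim, intro allI impI)
    fix n :: nat and t
    assume n: "c * real n powr (1 + \<kappa> * r - r') < 1 / 2" "real n powr (- 1) < 1 / 2"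
      "sum_tail n (s * real n powr (1 / p)) \<le> 4 * n * tail (real n powr \<kappa>) + real n powr (- (1 - r'))"
      "0 < n"
      and t: "tail (exp t) < exp (r * t)" "exp t \<le> real n powr \<kappa>" "real n powr \<kappa> \<le> 2 powr \<kappa> * exp t"
    have "real n powr \<kappa> * 2 powr (- \<kappa>) \<le> exp t"
      using t(3) by (simp add: powr_minus field_simps)
    \<comment> \<open>As \<open>r \<le> 0\<close>, the power reverses the inequality.\<close>
    then have "exp t powr r \<le> (real n powr \<kappa> * 2 powr (- \<kappa>)) powr r"
      using n(4) \<open>r \<le> 0\<close> by (intro powr_mono2') auto
    also have "\<dots> = real n powr (\<kappa> * r) * 2 powr (- \<kappa> * r)"
      by (simp add: powr_mult powr_powr)
    finally have "exp (r * t) \<le> real n powr (\<kappa> * r) * 2 powr (- \<kappa> * r)"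
      by (simp add: powr_def)
    then have "tail (real n powr \<kappa>) \<le> real n powr (\<kappa> * r) * 2 powr (- \<kappa> * r)"
      using tail_antimono[OF t(2)] t(1) by linarith
    then have "4 * n * tail (real n powr \<kappa>) \<le> 4 * n * (real n powr (\<kappa> * r) * 2 powr (- \<kappa> * r))"
      by (intro mult_left_mono) auto
    also have "\<dots> = real n powr r' * (c * real n powr (1 + \<kappa> * r - r'))"
      using n(4) by (simp add: c_def powr_add powr_diff)
    also have "\<dots> < real n powr r' * (1 / 2)"
      using n by (intro mult_strict_left_mono) auto
    finally have "4 * n * tail (real n powr \<kappa>) < real n powr r' * (1 / 2)" .
    moreover have "real n powr (- (1 - r')) = real n powr r' * real n powr (- 1)"
      by (simp only: powr_add[symmetric]) simp
    moreover have "real n powr r' * real n powr (- 1) < real n powr r' * (1 / 2)"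
      using n by (intro mult_strict_left_mono) auto
    ultimately show "sum_tail n (s * real n powr (1 / p)) < real n powr r'"
      using n(3) by linarith
  qed
  with \<kappa> show ?thesis by blast
qed

text \<open>The bound \<open>n * tail (2 * s * real n powr (1 / p)) / 4\<close> has order at least
  \<open>1 + r / p\<close>, and the strict gap to \<open>r'\<close> absorbs all constants. The
  window for \<open>exp t\<close> again leaves room for rounding \<open>n\<close>.\<close>

lemma less_sum_tail_transfer:
  assumes "0 < s" "r \<le> 0" "r' < 1 + r / p"
  shows "\<forall>\<^sub>F n in sequentially. \<forall>t. exp (r * t) < tail (exp t) \<longrightarrow>
    2 * s * real n powr (1 / p) \<le> exp t \<longrightarrow> exp t \<le> 2 * s * (2 * real n) powr (1 / p) \<longrightarrow>
    real n powr r' < sum_tail n (s * real n powr (1 / p))"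
proof -
  define c where "c = (2 * s * 2 powr (1 / p)) powr r / 4"
  have "c > 0" using assms by (simp add: c_def)
  then have "filterlim (\<lambda>n::nat. c * real n powr (1 + r / p - r')) at_top sequentially"
    by (rule filterlim_tendsto_pos_mult_at_top[OF tendsto_const]) (use assms(3) in real_asymp)
  then have "\<forall>\<^sub>F n::nat in sequentially. 1 < c * real n powr (1 + r / p - r')"
    by (simp add: filterlim_at_top_dense)
  moreover note eventually_sum_tail_ge[OF assms(1)] eventually_gt_at_top[of 0]
  ultimately show ?thesis
  proof (eventually_elim, intro allI impI)
    fix n :: nat and t
    assume n: "1 < c * real n powr (1 + r / p - r')"
      "n * tail (2 * s * real n powr (1 / p)) / 4 \<le> sum_tail n (s * real n powr (1 / p))" "0 < n"
      and t: "exp (r * t) < tail (exp t)" "2 * s * real n powr (1 / p) \<le> exp t"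
        "exp t \<le> 2 * s * (2 * real n) powr (1 / p)"
    have "(2 * s * 2 powr (1 / p)) powr r * real n powr (r / p) = (2 * s * (2 * real n) powr (1 / p)) powr r"
      using \<open>0 < s\<close> by (simp add: powr_mult powr_powr)
    also have "\<dots> \<le> exp t powr r"
      using t(3) \<open>r \<le> 0\<close> by (intro powr_mono2') auto
    also have "\<dots> = exp (r * t)" by (simp add: powr_def)
    also have "\<dots> \<le> tail (2 * s * real n powr (1 / p))"
      using t(1) tail_antimono[OF t(2)] by linarith
    finally have "n * ((2 * s * 2 powr (1 / p)) powr r * real n powr (r / p)) / 4 \<le> n * tail (2 * s * real n powr (1 / p)) / 4"
      by (intro divide_right_mono mult_left_mono) auto
    also note n(2)
    also have "n * ((2 * s * 2 powr (1 / p)) powr r * real n powr (r / p)) / 4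
        = real n powr r' * (c * real n powr (1 + r / p - r'))"
      using n(3) by (simp add: c_def powr_add powr_diff)
    finally have "real n powr r' * (c * real n powr (1 + r / p - r')) \<le> sum_tail n (s * real n powr (1 / p))" .
    moreover have "real n powr r' * 1 < real n powr r' * (c * real n powr (1 + r / p - r'))"
      using n by (intro mult_strict_left_mono) auto
    ultimately show "real n powr r' < sum_tail n (s * real n powr (1 / p))"
      by simp
  qed
qed

lemma filterlim_ceiling_exp:
  fixes \<kappa> :: real
  assumes "0 < \<kappa>"
  shows "filterlim (\<lambda>t. nat \<lceil>exp (t / \<kappa>)\<rceil>) sequentially at_top"
  unfolding filterlim_at_top
proof
  fix Z :: nat
  have "filterlim (\<lambda>t. exp (t / \<kappa>)) at_top at_top"
    using assms by real_asymp
  then have "\<forall>\<^sub>F t in at_top. real Z \<le> exp (t / \<kappa>)"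
    by (simp add: filterlim_at_top)
  then show "\<forall>\<^sub>F t in at_top. Z \<le> nat \<lceil>exp (t / \<kappa>)\<rceil>"
    by eventually_elim linarith
qed

text \<open>A probability is at most 1. This settles upper bounds with \<open>r > 0\<close>, outside
  the range of the transfer.\<close>

lemma eventually_sum_tail_less_powr:
  assumes "0 < r'"
  shows "\<forall>\<^sub>F n in sequentially. sum_tail n (x n) < real n powr r'"
  using eventually_gt_at_top[of 1]
proof eventually_elim
  case (elim n)
  then have "1 < real n powr r'" using assms by simp
  then show ?case using sum_tail_le_1[of n "x n"] by linarith
qed

text \<open>Each \<open>n\<close> is matched with \<open>t = \<kappa> * ln (real n)\<close>, for
  which \<open>exp t\<close> equals \<open>real n powr \<kappa>\<close>.\<close>

lemma eventually_sum_tail_less: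
  assumes "0 < s" "1 + r / p < r'" and ev: "\<forall>\<^sub>F t in at_top. tail (exp t) < exp (r * t)"
  shows "\<forall>\<^sub>F n in sequentially. sum_tail n (s * real n powr (1 / p)) < real n powr r'"
proof (cases "r \<le> 0")
  case True
  obtain \<kappa> where \<kappa>: "0 < \<kappa>" "\<kappa> < 1 / p"
    and tr: "\<forall>\<^sub>F n in sequentially. \<forall>t. tail (exp t) < exp (r * t) \<longrightarrow>
      exp t \<le> real n powr \<kappa> \<longrightarrow> real n powr \<kappa> \<le> 2 powr \<kappa> * exp t \<longrightarrow>
      sum_tail n (s * real n powr (1 / p)) < real n powr r'"
    using sum_tail_less_transfer[OF assms(1) True assms(2)] by blast
  have "filterlim (\<lambda>n::nat. \<kappa> * ln (real n)) at_top sequentially"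
    using \<kappa> by real_asymp
  from eventually_compose_filterlim[OF ev this] tr eventually_gt_at_top[of 0]
  show ?thesis
  proof eventually_elim
    case (elim n)
    have eq: "exp (\<kappa> * ln (real n)) = real n powr \<kappa>"
      using elim(3) by (simp add: powr_def)
    have "1 \<le> 2 powr \<kappa>" using \<kappa> by (simp add: ge_one_powr_ge_zero)
    then have "real n powr \<kappa> \<le> 2 powr \<kappa> * real n powr \<kappa>"
      using mult_right_mono[of 1 "2 powr \<kappa>" "real n powr \<kappa>"] by simp
    then show ?case
      using elim(1) elim(2)[rule_format, of "\<kappa> * ln (real n)"] unfolding eq by simp
  qed
next
  case False
  then have "0 < r / p" using p by simp
  then have "0 < r'" using assms(2) by linarith
  then show ?thesis by (rule eventually_sum_tail_less_powr)
qed

text \<open>Now \<open>n\<close> must be found from \<open>t\<close>. The contrapositive is used: an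
  eventual statement in \<open>n\<close> pulls back along the map from \<open>t\<close> to
  \<open>n\<close>, which tends to infinity.\<close>

lemma frequently_sum_tail_less:
  assumes "0 < s" "1 + r / p < r'" and fr: "\<exists>\<^sub>F t in at_top. tail (exp t) < exp (r * t)"
  shows "\<exists>\<^sub>F n in sequentially. sum_tail n (s * real n powr (1 / p)) < real n powr r'"
proof (cases "r \<le> 0")
  case True
  obtain \<kappa> where \<kappa>: "0 < \<kappa>" "\<kappa> < 1 / p"
    and tr: "\<forall>\<^sub>F n in sequentially. \<forall>t. tail (exp t) < exp (r * t) \<longrightarrow>
      exp t \<le> real n powr \<kappa> \<longrightarrow> real n powr \<kappa> \<le> 2 powr \<kappa> * exp t \<longrightarrow>
      sum_tail n (s * real n powr (1 / p)) < real n powr r'"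
    using sum_tail_less_transfer[OF assms(1) True assms(2)] by blast
  show ?thesis
    unfolding frequently_def
  proof
    assume "\<forall>\<^sub>F n in sequentially. \<not> sum_tail n (s * real n powr (1 / p)) < real n powr r'"
    with tr have "\<forall>\<^sub>F n in sequentially. \<forall>t. tail (exp t) < exp (r * t) \<longrightarrow>
        exp t \<le> real n powr \<kappa> \<longrightarrow> \<not> real n powr \<kappa> \<le> 2 powr \<kappa> * exp t"
      by eventually_elim blast
    from eventually_compose_filterlim[OF this filterlim_ceiling_exp[OF \<kappa>(1)]] eventually_ge_at_top[of 0]
    have "\<forall>\<^sub>F t in at_top. \<not> tail (exp t) < exp (r * t)"
    proof eventually_elim
      case (elim t)
      \<comment> \<open>Rounding up ensures \<open>exp t \<le> real n powr \<kappa>\<close>; as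
        \<open>exp (t / \<kappa>) \<ge> 1\<close>, it at most doubles the number.\<close>
      define n where "n = nat \<lceil>exp (t / \<kappa>)\<rceil>"
      have eq: "exp (t / \<kappa>) powr \<kappa> = exp t"
        using \<kappa> by (simp add: powr_def)
      have "1 \<le> exp (t / \<kappa>)" using elim(2) \<kappa> by simp
      then have n: "exp (t / \<kappa>) \<le> real n" "real n \<le> 2 * exp (t / \<kappa>)"
        unfolding n_def by linarith+
      have "exp (t / \<kappa>) powr \<kappa> \<le> real n powr \<kappa>"
        using n \<kappa> by (intro powr_mono2) auto
      moreover have "real n powr \<kappa> \<le> (2 * exp (t / \<kappa>)) powr \<kappa>"
        using n \<kappa> by (intro powr_mono2) auto
      ultimately show ?case
        using elim(1)[rule_format, of t] by (auto simp: powr_mult eq simp flip: n_def)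
    qed
    with fr show False by (simp add: frequently_def)
  qed
next
  case False
  then have "0 < r / p" using p by simp
  then have "0 < r'" using assms(2) by linarith
  then have "\<forall>\<^sub>F n in sequentially. sum_tail n (s * real n powr (1 / p)) < real n powr r'"
    by (rule eventually_sum_tail_less_powr)
  then show ?thesis by (intro eventually_frequently) simp_all
qed

text \<open>For \<open>r > 0\<close> the exponential exceeds 1 at every positive \<open>t\<close>.
  Lower bounds on the tail therefore carry the sign condition of the transfer with them.\<close>

lemma frequently_exp_less_tailD:
  assumes "\<exists>\<^sub>F t in at_top. exp (r * t) < tail (exp t)"
  shows "r \<le> 0"
proof (rule ccontr)
  assume "\<not> r \<le> 0"
  have "\<forall>\<^sub>F t in at_top. \<not> exp (r * t) < tail (exp t)"
    using eventually_gt_at_top[of 0]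
  proof eventually_elim
    case (elim t)
    then have "1 < exp (r * t)" using \<open>\<not> r \<le> 0\<close> by simp
    then show ?case using tail_le_1[of "exp t"] by linarith
  qed
  with assms show False by (simp add: frequently_def)
qed

lemma eventually_less_sum_tail:
  assumes "0 < s" "r' < 1 + r / p" and ev: "\<forall>\<^sub>F t in at_top. exp (r * t) < tail (exp t)"
  shows "\<forall>\<^sub>F n in sequentially. real n powr r' < sum_tail n (s * real n powr (1 / p))"
proof -
  have "r \<le> 0"
    using ev by (intro frequently_exp_less_tailD eventually_frequently) auto
  note tr = less_sum_tail_transfer[OF assms(1) this assms(2)]
  have "filterlim (\<lambda>n::nat. ln (2 * s * real n powr (1 / p))) at_top sequentially"
    using assms(1) by (intro filterlim_compose[OF ln_at_top] filterlim_scaled_root_at_top) simp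
  from eventually_compose_filterlim[OF ev this] tr eventually_gt_at_top[of 0]
  show ?thesis
  proof eventually_elim
    case (elim n)
    have eq: "exp (ln (2 * s * real n powr (1 / p))) = 2 * s * real n powr (1 / p)"
      using elim(3) assms(1) by (intro exp_ln) simp
    have "2 * s * real n powr (1 / p) \<le> 2 * s * (2 * real n) powr (1 / p)"
      using assms(1) p by (intro mult_left_mono powr_mono2) auto
    then show ?case
      using elim(1) elim(2)[rule_format, of "ln (2 * s * real n powr (1 / p))"] unfolding eq by simp
  qed
qed

text \<open>Contrapositive and pull-back along \<open>t\<close>, with \<open>n\<close> now rounded
  down: the level \<open>2 * s * real n powr (1 / p)\<close> must not exceed
  \<open>exp t\<close>.\<close>

lemma frequently_less_sum_tail:
  assumes "0 < s" "r' < 1 + r / p" and fr: "\<exists>\<^sub>F t in at_top. exp (r * t) < tail (exp t)"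
  shows "\<exists>\<^sub>F n in sequentially. real n powr r' < sum_tail n (s * real n powr (1 / p))"
  unfolding frequently_def
proof
  assume "\<forall>\<^sub>F n in sequentially. \<not> real n powr r' < sum_tail n (s * real n powr (1 / p))"
  with less_sum_tail_transfer[OF assms(1) frequently_exp_less_tailD[OF fr] assms(2)]
  have "\<forall>\<^sub>F n in sequentially. \<forall>t. exp (r * t) < tail (exp t) \<longrightarrow>
      2 * s * real n powr (1 / p) \<le> exp t \<longrightarrow> \<not> exp t \<le> 2 * s * (2 * real n) powr (1 / p)"
    by eventually_elim blast
  moreover have lim: "filterlim (\<lambda>t. (exp t / (2 * s)) powr p) at_top at_top"
    using assms(1) p by real_asymp
  then have "filterlim (\<lambda>t. nat \<lfloor>(exp t / (2 * s)) powr p\<rfloor>) sequentially at_top"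
    by (intro filterlim_compose[OF filterlim_nat_sequentially] filterlim_compose[OF filterlim_floor_sequentially])
  ultimately have "\<forall>\<^sub>F u in at_top. \<forall>t. exp (r * t) < tail (exp t) \<longrightarrow>
      2 * s * real (nat \<lfloor>(exp u / (2 * s)) powr p\<rfloor>) powr (1 / p) \<le> exp t \<longrightarrow>
      \<not> exp t \<le> 2 * s * (2 * real (nat \<lfloor>(exp u / (2 * s)) powr p\<rfloor>)) powr (1 / p)"
    by (rule eventually_compose_filterlim)
  moreover have "\<forall>\<^sub>F t in at_top. 1 \<le> (exp t / (2 * s)) powr p"
    using lim by (simp add: filterlim_at_top)
  ultimately have "\<forall>\<^sub>F t in at_top. \<not> exp (r * t) < tail (exp t)"
  proof eventually_elim
    case (elim t)
    define n where "n = nat \<lfloor>(exp t / (2 * s)) powr p\<rfloor>"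
    note n = nat_floor_bounds[OF elim(2), folded n_def]
    have eq: "2 * s * ((exp t / (2 * s)) powr p) powr (1 / p) = exp t"
      using p assms(1) by (simp add: powr_powr)
    have "2 * s * real n powr (1 / p) \<le> 2 * s * ((exp t / (2 * s)) powr p) powr (1 / p)"
      using n assms(1) p by (intro mult_left_mono powr_mono2) auto
    moreover have "2 * s * ((exp t / (2 * s)) powr p) powr (1 / p) \<le> 2 * s * (2 * real n) powr (1 / p)"
      using n assms(1) p by (intro mult_left_mono powr_mono2) auto
    ultimately show ?case
      using elim(1)[rule_format, of t] unfolding eq n_def by blast
  qed
  with fr show False by (simp add: frequently_def)
qed

section \<open>The rates as upper and lower limits\<close>

lemma measure_log_norm_gt: "measure M (log_norm_gt M (X 0) t) = tail (exp t)"
proof -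
  have "0 < y \<and> t < ln y \<longleftrightarrow> exp t < y" for y :: real
    by (metis exp_gt_zero exp_less_cancel_iff exp_ln less_trans)
  then show ?thesis
    by (simp only: log_norm_gt_def tail_def)
qed

lemma log_tail_less_iff:
  "0 < t \<Longrightarrow> ereal (1 / t) * elog (measure M (log_norm_gt M (X 0) t)) < ereal r \<longleftrightarrow> tail (exp t) < exp (r * t)"
  by (simp only: measure_log_norm_gt elog_scaled_less_iff)

lemma less_log_tail_iff:
  "0 < t \<Longrightarrow> ereal r < ereal (1 / t) * elog (measure M (log_norm_gt M (X 0) t)) \<longleftrightarrow> exp (r * t) < tail (exp t)"
  by (simp only: measure_log_norm_gt less_elog_scaled_iff)

text \<open>The scaled logarithm is taken at \<open>t = ln (real n)\<close>, which is positive for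
  \<open>1 < n\<close>, and \<open>exp (r * ln (real n))\<close> is
  \<open>real n powr r\<close>.\<close>

lemma tail_rate_less_iff:
  "1 < n \<Longrightarrow> tail_rate M S p s n < ereal r \<longleftrightarrow> sum_tail n (s * real n powr (1 / p)) < real n powr r"
  by (simp add: tail_rate_def elog_scaled_less_iff sum_tail_def powr_def)

lemma less_tail_rate_iff:
  "1 < n \<Longrightarrow> ereal r < tail_rate M S p s n \<longleftrightarrow> real n powr r < sum_tail n (s * real n powr (1 / p))"
  by (simp add: tail_rate_def less_elog_scaled_iff sum_tail_def powr_def)

text \<open>A number above an upper limit bounds the function eventually, one below it is exceeded
  frequently. So the eventual upper transfer and the frequent lower transfer give the two
  inequalities.\<close>

lemma Limsup_tail_rate:
  assumes "0 < s"
  shows "Limsup sequentially (tail_rate M S p s) = - (beta_upper M (X 0) - ereal p) / ereal p"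
proof (rule ereal_affine_eqI[OF p(1)])
  let ?h = "\<lambda>t. ereal (1 / t) * elog (measure M (log_norm_gt M (X 0) t))"
  fix r r' :: real
  {
    assume "- beta_upper M (X 0) < ereal r" "1 + r / p < r'"
    then have "\<forall>\<^sub>F t in at_top. ?h t < ereal r"
      by (intro Limsup_lessD) (simp add: beta_upper_def)
    with eventually_gt_at_top[of 0] have "\<forall>\<^sub>F t in at_top. tail (exp t) < exp (r * t)"
      by eventually_elim (simp only: log_tail_less_iff)
    from eventually_sum_tail_less[OF assms \<open>1 + r / p < r'\<close> this] eventually_gt_at_top[of 1]
    have "\<forall>\<^sub>F n in sequentially. tail_rate M S p s n \<le> ereal r'"
      by eventually_elim (simp add: tail_rate_less_iff less_imp_le)
    then show "Limsup sequentially (tail_rate M S p s) \<le> ereal r'"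
      by (rule Limsup_bounded)
  }
  {
    assume r: "ereal r < - beta_upper M (X 0)" "r' < 1 + r / p"
    have "\<exists>\<^sub>F t in at_top. exp (r * t) < tail (exp t)"
      unfolding frequently_def
    proof
      assume "\<forall>\<^sub>F t in at_top. \<not> exp (r * t) < tail (exp t)"
      with eventually_gt_at_top[of 0] have "\<forall>\<^sub>F t in at_top. ?h t \<le> ereal r"
        by eventually_elim (simp only: less_log_tail_iff[symmetric] not_less)
      then have "Limsup at_top ?h \<le> ereal r"
        by (rule Limsup_bounded)
      with r(1) show False by (simp add: beta_upper_def)
    qed
    from frequently_less_sum_tail[OF assms r(2) this]
    have fr: "\<exists>\<^sub>F n in sequentially. real n powr r' < sum_tail n (s * real n powr (1 / p))" .
    show "ereal r' \<le> Limsup sequentially (tail_rate M S p s)"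
    proof (rule ccontr)
      assume "\<not> ?thesis"
      then have "\<forall>\<^sub>F n in sequentially. tail_rate M S p s n < ereal r'"
        by (intro Limsup_lessD) (simp add: not_le)
      with eventually_gt_at_top[of 1]
      have "\<forall>\<^sub>F n in sequentially. \<not> real n powr r' < sum_tail n (s * real n powr (1 / p))"
        by eventually_elim (simp add: tail_rate_less_iff)
      with fr show False by (simp add: frequently_def)
    qed
  }
qed

text \<open>The roles are exchanged: lower bounds hold eventually and upper bounds
  frequently.\<close>

lemma Liminf_tail_rate:
  assumes "0 < s"
  shows "Liminf sequentially (tail_rate M S p s) = - (beta_lower M (X 0) - ereal p) / ereal p"
proof (rule ereal_affine_eqI[OF p(1)])
  let ?h = "\<lambda>t. ereal (1 / t) * elog (measure M (log_norm_gt M (X 0) t))"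
  fix r r' :: real
  {
    assume "ereal r < - beta_lower M (X 0)" "r' < 1 + r / p"
    then have "\<forall>\<^sub>F t in at_top. ereal r < ?h t"
      by (intro less_LiminfD) (simp add: beta_lower_def)
    with eventually_gt_at_top[of 0] have "\<forall>\<^sub>F t in at_top. exp (r * t) < tail (exp t)"
      by eventually_elim (simp only: less_log_tail_iff)
    from eventually_less_sum_tail[OF assms \<open>r' < 1 + r / p\<close> this] eventually_gt_at_top[of 1]
    have "\<forall>\<^sub>F n in sequentially. ereal r' \<le> tail_rate M S p s n"
      by eventually_elim (simp add: less_tail_rate_iff less_imp_le)
    then show "ereal r' \<le> Liminf sequentially (tail_rate M S p s)"
      by (rule Liminf_bounded)
  }
  {
    assume r: "- beta_lower M (X 0) < ereal r" "1 + r / p < r'"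
    have "\<exists>\<^sub>F t in at_top. tail (exp t) < exp (r * t)"
      unfolding frequently_def
    proof
      assume "\<forall>\<^sub>F t in at_top. \<not> tail (exp t) < exp (r * t)"
      with eventually_gt_at_top[of 0] have "\<forall>\<^sub>F t in at_top. ereal r \<le> ?h t"
        by eventually_elim (simp only: log_tail_less_iff[symmetric] not_less)
      then have "ereal r \<le> Liminf at_top ?h"
        by (rule Liminf_bounded)
      with r(1) show False by (simp add: beta_lower_def)
    qed
    from frequently_sum_tail_less[OF assms r(2) this]
    have fr: "\<exists>\<^sub>F n in sequentially. sum_tail n (s * real n powr (1 / p)) < real n powr r'" .
    show "Liminf sequentially (tail_rate M S p s) \<le> ereal r'"
    proof (rule ccontr)
      assume "\<not> ?thesis"
      then have "\<forall>\<^sub>F n in sequentially. ereal r' < tail_rate M S p s n"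
        by (intro less_LiminfD) (simp add: not_le)
      with eventually_gt_at_top[of 1]
      have "\<forall>\<^sub>F n in sequentially. \<not> sum_tail n (s * real n powr (1 / p)) < real n powr r'"
        by eventually_elim (simp add: less_tail_rate_iff)
      with fr show False by (simp add: frequently_def)
    qed
  }
qed

end

theorem theorem2p1:
  fixes M :: "'a measure"
    and X :: "nat \<Rightarrow> 'a \<Rightarrow> 'b::{banach, second_countable_topology}"
    and p :: real
  defines "S \<equiv> (\<lambda>n \<omega>. \<Sum>i\<in>{1..n}. X i \<omega>)"
  assumes "prob_space M"
    and "0 < p" and "p < 2"
    and meas: "\<And>i. X i \<in> borel_measurable M"
    and indep: "prob_space.indep_vars M (\<lambda>_. borel) X UNIV"
    and ident: "\<And>i. distr M borel (X i) = distr M borel (X 0)"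
    and conv: "\<And>\<epsilon>. \<epsilon> > 0 \<Longrightarrow>
      (\<lambda>n. measure M {\<omega> \<in> space M. norm (S n \<omega>) / real n powr (1 / p) > \<epsilon>}) \<longlonglongrightarrow> 0"
  shows "(\<forall>s>0. Limsup sequentially (tail_rate M S p s)
                   = - (beta_upper M (X 0) - ereal p) / ereal p
             \<and> Liminf sequentially (tail_rate M S p s)
                   = - (beta_lower M (X 0) - ereal p) / ereal p)
      \<and> (\<forall>s>0. \<forall>\<beta>::ereal. 0 \<le> \<beta> \<longrightarrow>
            ((tail_rate M S p s \<longlongrightarrow> - (\<beta> - ereal p) / ereal p) sequentially
             \<longleftrightarrow> (beta_upper M (X 0) = \<beta> \<and> beta_lower M (X 0) = \<beta>)))"
proof -
  interpret iid: iid_weak_law M X p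
    by (rule iid_weak_law.intro[OF assms(2)
          iid_weak_law_axioms.intro[OF assms(3,4) meas indep ident conv[unfolded S_def]]])
  have S: "iid.S = S"
    by (simp add: fun_eq_iff iid.S_def S_def)
  note sup = iid.Limsup_tail_rate[unfolded S] and inf = iid.Liminf_tail_rate[unfolded S]
  \<comment> \<open>The limit determines the exponent, also at infinity; this turns equality of
    limits into equality of \<open>\<beta>\<close> with both tail exponents.\<close>
  have inj: "- (a - ereal p) / ereal p = - (b - ereal p) / ereal p \<longleftrightarrow> a = b" for a b
    using ereal_affine_inj[OF _ \<open>0 < p\<close>, of a b] by auto
  have "(tail_rate M S p s \<longlongrightarrow> - (\<beta> - ereal p) / ereal p) sequentially
      \<longleftrightarrow> (beta_upper M (X 0) = \<beta> \<and> beta_lower M (X 0) = \<beta>)" if "s > 0" for s \<beta>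
  proof -
    have "(tail_rate M S p s \<longlongrightarrow> - (\<beta> - ereal p) / ereal p) sequentially
      \<longleftrightarrow> Liminf sequentially (tail_rate M S p s) = - (\<beta> - ereal p) / ereal p
        \<and> Limsup sequentially (tail_rate M S p s) = - (\<beta> - ereal p) / ereal p"
      by (rule tendsto_iff_Liminf_eq_Limsup) simp
    then show ?thesis
      unfolding sup[OF that] inf[OF that] inj by blast
  qed
  then show ?thesis using sup inf by blast
qed

end
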